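(* Let $\varepsilon,\delta>0$ and $t\in\mathbb{N}$ be arbitrary, let $\mathcal{F}$ be a finite family of bicolored graphs, and let $c=\mathrm{ex}(\varepsilon,\mathcal{F})$. Then for all sufficiently large $n$ (with respect to $\mathcal{F},\varepsilon,t,\delta$), every $\varepsilon$-balanced bicolored graph on $n$ vertices with $(c+\delta)\binom{n}{2}$ edges contains a $t$-blow-up of some $F\in\mathcal{F}$.
   Context: A bicolored graph is a simple graph whose edges are each colored red or blue. A bicolored graph $G$ is $\varepsilon$-balanced if each color class contains at least $\varepsilon\cdot e(G)$ edges. $G$ contains $F$ if there is an injective map $V(F)\to V(G)$ sending every edge of $F$ to an edge of $G$ of the same color. For a family $\mathcal{F}$, $\mathrm{ex}(\varepsilon,n,\mathcal{F})$ is the maximum number of edges of an $n$-vertex $\varepsilon$-balanced bicolored graph containing no member of $\mathcal{F}$, and $\mathrm{ex}(\varepsilon,\mathcal{F}):=\lim_{n\to\infty}\mathrm{ex}(\varepsilon,n,\mathcal{F})/\binom{n}{2}$. The $t$-blow-up of a bicolored graph $F$ is obtained by replacing each vertex of $F$ by an independent set of $t$ vertices and each edge $uv$ of $F$ by a complete bipartite graph between the sets of $u$ and $v$, all of whose edges have the color of $uv$. *)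

theory Defs
  imports Complex_Main
begin

record 'v bicolored =
  verts :: "'v set"
  red :: "'v set set"
  blue :: "'v set set"

definition bicolored_graph :: "'v bicolored \<Rightarrow> bool" where
  "bicolored_graph G \<longleftrightarrow>
     finite (verts G) \<and>
     (\<forall>e \<in> red G \<union> blue G. e \<subseteq> verts G \<and> card e = 2) \<and>
     red G \<inter> blue G = {}"

definition edges :: "'v bicolored \<Rightarrow> 'v set set" where
  "edges G = red G \<union> blue G"

definition balanced :: "real \<Rightarrow> 'v bicolored \<Rightarrow> bool" where
  "balanced \<epsilon> G \<longleftrightarrow>
     real (card (red G)) \<ge> \<epsilon> * real (card (edges G)) \<and>
     real (card (blue G)) \<ge> \<epsilon> * real (card (edges G))"

definition contains :: "'w bicolored \<Rightarrow> 'v bicolored \<Rightarrow> bool" where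
  "contains G F \<longleftrightarrow>
     (\<exists>f. inj_on f (verts F) \<and> f ` verts F \<subseteq> verts G \<and>
          (\<forall>e \<in> red F. f ` e \<in> red G) \<and> (\<forall>e \<in> blue F. f ` e \<in> blue G))"

text \<open>
  The host graphs have vertices in \<^typ>\<open>nat\<close>, which represents every finite graph up to
  isomorphism. The set below is bounded by \<^term>\<open>n choose 2\<close>, so its supremum is its maximum
  whenever it is nonempty. It can be empty only if some member of the family has no edges; the
  value is then 0, since \<^term>\<open>Sup {} = (0::nat)\<close>.
\<close>

definition ex_num :: "real \<Rightarrow> nat \<Rightarrow> 'v bicolored set \<Rightarrow> nat" where
  "ex_num \<epsilon> n \<F> =
     Sup {card (edges G) | G :: nat bicolored.
            bicolored_graph G \<and> card (verts G) = n \<and> balanced \<epsilon> G \<and>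
            (\<forall>F \<in> \<F>. \<not> contains G F)}"

definition ex_density :: "real \<Rightarrow> 'v bicolored set \<Rightarrow> real" where
  "ex_density \<epsilon> \<F> = lim (\<lambda>n. real (ex_num \<epsilon> n \<F>) / real (n choose 2))"

definition blow_up :: "nat \<Rightarrow> 'v bicolored \<Rightarrow> ('v \<times> nat) bicolored" where
  "blow_up t F =
     \<lparr>verts = verts F \<times> {..<t},
      red = {{(u, i), (v, j)} | u v i j. {u, v} \<in> red F \<and> i < t \<and> j < t},
      blue = {{(u, i), (v, j)} | u v i j. {u, v} \<in> blue F \<and> i < t \<and> j < t}\<rparr>"

end

theory Submission
  imports Defs "HOL-Library.FuncSet"
begin

text \<open>
  Let \<open>G\<close> be an \<open>\<epsilon>\<close>-balanced graph on a large vertex set \<open>V\<close> and pull its colouring back along a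
  uniformly random map \<open>\<phi>\<close> from \<open>{..<m}\<close> to \<open>V\<close>. By Chebyshev's inequality the densities of both
  colours are nearly preserved with high probability, and \<open>\<phi>\<close> is injective with high probability;
  the pulled-back graph is then made exactly balanced by deleting few edges. Hence at least half of
  all maps \<open>\<phi>\<close> embed an \<open>\<epsilon>\<close>-balanced graph on \<open>m\<close> vertices whose density is almost that of \<open>G\<close>.

  Applied to extremal graphs this shows that the densities of the extremal numbers are almost
  decreasing, so they converge. Applied to a graph of density at least \<open>c + \<delta>\<close>, with \<open>m\<close> such that
  the extremal density for \<open>m\<close> is below \<open>c + \<delta> / 3\<close>, it shows that half of all maps \<open>\<phi>\<close> embed a
  graph containing a member of the family. By pigeonhole a single pair of some \<open>F\<close> and a position of
  \<open>F\<close> in \<open>{..<m}\<close> serves a positive proportion of the \<open>\<phi>\<close>, and Erdos's theorem on complete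
  \<open>m\<close>-partite subhypergraphs gives a box of such maps, which is a blow-up of \<open>F\<close>.
\<close>

subsection \<open>Boxes in dense sets of tuples\<close>

text \<open>Induction on \<open>I\<close>. A positive proportion of the tuples over \<open>I\<close>
  has a large fibre in the new direction \<open>i\<close>. Double counting the
  \<open>t\<close>-subsets of these fibres gives one \<open>t\<close>-set common to the fibres of
  many tuples, and the induction hypothesis finds a box among those tuples. The density is arbitrary
  in the induction because it changes at each step.\<close>

lemma erdos_box:
  fixes \<beta> :: real
  assumes "finite I" "\<beta> > 0" "t > 0"
  shows "\<exists>N. \<forall>V :: 'a set. \<forall>S. finite V \<and> card V \<ge> N \<and> S \<subseteq> (I \<rightarrow>\<^sub>E V) \<and>
           real (card S) \<ge> \<beta> * real (card V) ^ card I \<longrightarrow>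
           (\<exists>A. (\<forall>i\<in>I. A i \<subseteq> V \<and> card (A i) = t) \<and> PiE I A \<subseteq> S)"
  using assms
proof (induction I arbitrary: \<beta> rule: finite_induct)
  case empty
  have "(\<exists>A. (\<forall>i\<in>{}. A i \<subseteq> V \<and> card (A i) = t) \<and> PiE {} A \<subseteq> S)"
    if "S \<subseteq> ({} \<rightarrow>\<^sub>E V)" "real (card S) \<ge> \<beta> * real (card V) ^ card {}" for V :: "'a set" and S :: "('i \<Rightarrow> 'a) set"
  proof -
    have "card S \<noteq> 0" using that(2) empty.prems by auto
    then have "S \<noteq> {}" by auto
    then show ?thesis using that(1) by (auto simp: PiE_empty_domain)
  qed
  then show ?case by blast
next
  case (insert i I)
  \<comment> \<open>\<open>\<beta>/2\<close> bounds the proportion of tuples with a fibre of at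
    least \<open>\<beta>/2 * n\<close> elements. Such a fibre has at least
    \<open>(\<beta> * n / (2 * t)) ^ t\<close> subsets of size \<open>t\<close>, out of at most
    \<open>n ^ t\<close> candidates.\<close>
  define \<gamma> where "\<gamma> = (\<beta>/2) * (\<beta> / (2 * real t)) ^ t"
  have \<gamma>: "\<gamma> > 0" using insert.prems by (simp add: \<gamma>_def)
  obtain N where "\<forall>V :: 'a set. \<forall>S. finite V \<and> card V \<ge> N \<and> S \<subseteq> (I \<rightarrow>\<^sub>E V) \<and>
           real (card S) \<ge> \<gamma> * real (card V) ^ card I \<longrightarrow>
           (\<exists>A. (\<forall>i\<in>I. A i \<subseteq> V \<and> card (A i) = t) \<and> PiE I A \<subseteq> S)"
    using insert.IH[OF \<gamma> insert.prems(2)] by (rule exE)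
  note N = this[rule_format, OF conjI, OF _ conjI, OF _ _ conjI]
  \<comment> \<open>The last bound ensures that a fibre of \<open>\<beta>/2 * n\<close> elements has
    at least \<open>t\<close> elements, as the lower bound on its number of \<open>t\<close>-subsets
    requires.\<close>
  define M where "M = max (max N 1) (nat \<lceil>2 * real t / \<beta>\<rceil>)"
  have key: "\<exists>A. (\<forall>j\<in>insert i I. A j \<subseteq> V \<and> card (A j) = t) \<and> PiE (insert i I) A \<subseteq> S"
    if V: "finite V" "card V \<ge> M" and S: "S \<subseteq> (insert i I \<rightarrow>\<^sub>E V)"
      "real (card S) \<ge> \<beta> * real (card V) ^ card (insert i I)"
    for V :: "'a set" and S
  proof -
    define n where "n = card V"
    define P where "P = (I \<rightarrow>\<^sub>E V)"
    define D where "D x = {v\<in>V. x(i := v) \<in> S}" for x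
    define X where "X = {x\<in>P. real (card (D x)) \<ge> \<beta>/2 * real n}"
    define T where "T = {A. A \<subseteq> V \<and> card A = t}"
    have n: "n \<ge> N" "n \<ge> 1" "real n \<ge> 2 * real t / \<beta>" using V by (auto simp: M_def n_def)
    have finP: "finite P" unfolding P_def using insert.hyps V by (intro finite_PiE) auto
    have finD: "finite (D x)" for x using V by (simp add: D_def)
    have cardP: "card P = n ^ card I" using insert.hyps by (simp add: P_def card_PiE n_def)
    have XP: "X \<subseteq> P" by (auto simp: X_def)
    have finX: "finite X" using XP finP by (rule finite_subset)
    have "bij_betw (\<lambda>(x,v). x(i := v)) (Sigma P D) S"
      unfolding bij_betw_def
    proof
      show "inj_on (\<lambda>(x,v). x(i := v)) (Sigma P D)"
      proof (intro inj_onI, clarify)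
        fix x v y w assume a: "x \<in> P" "y \<in> P" "x(i := v) = y(i := w)"
        have "v = w" using a(3) by (metis fun_upd_same)
        \<comment> \<open>\<open>i\<close> lies outside \<open>I\<close>, so both maps take the
          default value \<open>undefined\<close> there and the update at \<open>i\<close> can be
          undone.\<close>
        moreover have "x i = y i" using PiE_arb[of x I "\<lambda>_. V" i] PiE_arb[of y I "\<lambda>_. V" i] a(1,2) insert.hyps(2) by (simp add: P_def)
        then have "x = y" using a(3) by (metis fun_upd_triv fun_upd_upd)
        ultimately show "x = y \<and> v = w" by simp
      qed
      show "(\<lambda>(x,v). x(i := v)) ` Sigma P D = S"
      proof
        show "(\<lambda>(x,v). x(i := v)) ` Sigma P D \<subseteq> S" by (auto simp: D_def)
        show "S \<subseteq> (\<lambda>(x,v). x(i := v)) ` Sigma P D"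
        proof
          fix s assume s: "s \<in> S"
          then have "s \<in> (\<lambda>(y, g). g(i := y)) ` (V \<times> (I \<rightarrow>\<^sub>E V))"
            using S(1) by (auto simp: PiE_insert_eq)
          then show "s \<in> (\<lambda>(x,v). x(i := v)) ` Sigma P D" using s
            by (force simp: D_def P_def)
        qed
      qed
    qed
    then have "card S = (\<Sum>x\<in>P. card (D x))"
      using finP finD by (simp add: bij_betw_same_card[symmetric])
    then have "real (card S) = (\<Sum>x\<in>X. real (card (D x))) + (\<Sum>x\<in>P-X. real (card (D x)))"
      using sum.subset_diff[OF XP finP, of "\<lambda>x. real (card (D x))"] by simp
    \<comment> \<open>Outside \<open>X\<close> the fibres account for at most half of the assumed
      size of \<open>S\<close>; over \<open>X\<close> the trivial bound \<open>n\<close> on a fibre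
      suffices.\<close>
    also have "\<dots> \<le> (\<Sum>x\<in>X. real n) + (\<Sum>x\<in>P-X. \<beta>/2 * real n)"
      using V by (intro add_mono sum_mono) (auto simp: X_def D_def n_def intro!: card_mono)
    also have "\<dots> \<le> card X * real n + card P * (\<beta>/2 * real n)"
      using insert.prems finP by (auto intro!: mult_right_mono card_mono)
    finally have *: "\<beta> * real n ^ card I * real n \<le> card X * real n + \<beta>/2 * real n ^ card I * real n"
      using S(2) insert.hyps by (simp add: cardP n_def[symmetric] mult.commute mult.left_commute)
    have "\<beta> * real n ^ card I \<le> card X + \<beta>/2 * real n ^ card I"
    proof -
      have "(\<beta> * real n ^ card I) * real n \<le> (card X + \<beta>/2 * real n ^ card I) * real n"
        using * by (simp only: distrib_right)
      then show ?thesis using n by (simp only: mult_le_cancel_right_pos of_nat_0_less_iff)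
    qed
    then have cX: "real (card X) \<ge> \<beta>/2 * real n ^ card I" by simp
    have finT: "finite T" using V by (simp add: T_def)
    have cT: "real (card T) \<le> real n ^ t"
    proof -
      have "card T = n choose t" using V n_subsets[of V t] by (simp add: T_def n_def)
      moreover have "n choose t \<le> n ^ t"
        by (cases "t \<le> n") (auto simp: binomial_le_pow binomial_eq_0)
      ultimately show ?thesis by (metis of_nat_le_iff of_nat_power)
    qed
    have deg: "real (card {A\<in>T. A \<subseteq> D x}) \<ge> (\<beta> * real n / (2 * real t)) ^ t" if "x \<in> X" for x
    proof -
      have d: "real (card (D x)) \<ge> \<beta>/2 * real n" using that by (simp add: X_def)
      moreover have "\<beta>/2 * real n \<ge> real t" using n(3) insert.prems by (simp add: field_simps)
      ultimately have td: "t \<le> card (D x)" by linarith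
      have "{A\<in>T. A \<subseteq> D x} = {A. A \<subseteq> D x \<and> card A = t}" by (auto simp: T_def D_def)
      then have "card {A\<in>T. A \<subseteq> D x} = card (D x) choose t" using n_subsets[OF finD] by simp
      moreover have "(real (card (D x)) / real t) ^ t \<le> real (card (D x) choose t)"
        using binomial_ge_n_over_k_pow_k[OF td, where 'a = real] by simp
      moreover have "(\<beta> * real n / (2 * real t)) ^ t \<le> (real (card (D x)) / real t) ^ t"
        using d insert.prems by (intro power_mono) (auto simp: field_simps)
      ultimately show ?thesis by simp
    qed
    \<comment> \<open>If every \<open>t\<close>-set lay in too few fibres, counting the pairs of an
      \<open>x\<close> and a \<open>t\<close>-set inside \<open>D x\<close> in both orders would
      give a contradiction.\<close>
    have "\<exists>A\<in>T. real (card {x\<in>X. A \<subseteq> D x}) \<ge> \<gamma> * real n ^ card I"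
    proof (rule ccontr)
      assume "\<not> ?thesis"
      then have less: "\<And>A. A \<in> T \<Longrightarrow> real (card {x\<in>X. A \<subseteq> D x}) < \<gamma> * real n ^ card I" by force
      have ne: "T \<noteq> {}"
      proof -
        have "real t \<le> \<beta>/2 * real n" using n(3) insert.prems by (simp add: field_simps)
        moreover have "card X \<noteq> 0"
          using cX n insert.prems by (metis linorder_not_less of_nat_0 zero_less_power half_gt_zero mult_pos_pos of_nat_0_less_iff less_le_trans zero_less_one)
        then obtain x where "x \<in> X" by fastforce
        ultimately have "(\<beta> * real n / (2 * real t)) ^ t \<le> real (card {A\<in>T. A \<subseteq> D x})" using deg by blast
        moreover have "(\<beta> * real n / (2 * real t)) ^ t > 0" using n insert.prems by simp
        ultimately have "card {A\<in>T. A \<subseteq> D x} \<noteq> 0" by linarith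
        then show ?thesis by auto
      qed
      have "(\<beta>/2 * real n ^ card I) * (\<beta> * real n / (2 * real t)) ^ t \<le> real (card X) * (\<beta> * real n / (2 * real t)) ^ t"
        using cX insert.prems by (intro mult_right_mono) auto
      also have "\<dots> = (\<Sum>x\<in>X. (\<beta> * real n / (2 * real t)) ^ t)" by simp
      also have "\<dots> \<le> (\<Sum>x\<in>X. real (card {A\<in>T. A \<subseteq> D x}))" using deg by (intro sum_mono)
      also have "\<dots> = (\<Sum>A\<in>T. real (card {x\<in>X. A \<subseteq> D x}))"
        using sum_multicount_gen[OF finX finT, of "\<lambda>x A. A \<subseteq> D x" "\<lambda>A. card {x\<in>X. A \<subseteq> D x}"]
        by (simp flip: of_nat_sum)
      also have "\<dots> < (\<Sum>A\<in>T. \<gamma> * real n ^ card I)" using less finT ne by (intro sum_strict_mono) auto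
      also have "\<dots> \<le> real n ^ t * (\<gamma> * real n ^ card I)" using cT \<gamma> by (simp add: mult_right_mono)
      also have "\<dots> = (\<beta>/2 * real n ^ card I) * (\<beta> * real n / (2 * real t)) ^ t"
        by (simp add: \<gamma>_def power_mult_distrib power_divide)
      finally show False by simp
    qed
    then obtain B where B: "B \<in> T" "real (card {x\<in>X. B \<subseteq> D x}) \<ge> \<gamma> * real n ^ card I" by blast
    have "\<exists>A. (\<forall>i\<in>I. A i \<subseteq> V \<and> card (A i) = t) \<and> PiE I A \<subseteq> {x\<in>X. B \<subseteq> D x}"
    proof (rule N)
      show "{x\<in>X. B \<subseteq> D x} \<subseteq> (I \<rightarrow>\<^sub>E V)" using XP by (auto simp: P_def)
    qed (use V n B in \<open>simp_all add: n_def\<close>)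
    then obtain A where A: "\<And>j. j \<in> I \<Longrightarrow> A j \<subseteq> V \<and> card (A j) = t" "PiE I A \<subseteq> {x\<in>X. B \<subseteq> D x}" by blast
    have eq: "PiE I (A(i := B)) = PiE I A" using insert.hyps by (intro PiE_cong) auto
    have "PiE (insert i I) (A(i := B)) \<subseteq> S"
      unfolding PiE_insert_eq eq using A(2) by (auto simp: D_def)
    moreover have "\<forall>j\<in>insert i I. (A(i := B)) j \<subseteq> V \<and> card ((A(i := B)) j) = t"
      using A(1) B(1) by (auto simp: T_def)
    ultimately show ?thesis by blast
  qed
  show ?case by (intro exI[of _ M] allI impI key; (elim conjE)?; assumption)
qed

subsection \<open>Concentration of pair counts\<close>

text \<open>The coordinates outside \<open>J\<close> are free. Multiplying by
  \<open>card V ^ card J\<close> instead of dividing keeps the identity within the natural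
  numbers.\<close>

lemma card_PiE_fixed:
  assumes "finite I" "J \<subseteq> I" "\<And>j. j \<in> J \<Longrightarrow> a j \<in> V"
  shows "card {\<phi> \<in> I \<rightarrow>\<^sub>E V. \<forall>j\<in>J. \<phi> j = a j} * card V ^ card J = card V ^ card I"
proof -
  have "{\<phi> \<in> I \<rightarrow>\<^sub>E V. \<forall>j\<in>J. \<phi> j = a j} = (\<Pi>\<^sub>E k\<in>I. if k \<in> J then {a k} else V)"
    using assms by (fastforce simp: PiE_iff split: if_splits)
  also have "card \<dots> = (\<Prod>k\<in>I. if k \<in> J then 1 else card V)"
    using assms(1) by (simp add: card_PiE if_distrib cong: if_cong)
  also have "\<dots> = card V ^ card (I - J)"
    using assms by (simp add: prod.If_cases Int_Diff Diff_eq)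
  finally show ?thesis using assms(1,2)
    by (simp flip: power_add add: card_Diff_subset finite_subset card_mono)
qed

text \<open>At two distinct indices a uniformly random map takes independent uniform values, so the
  event has probability \<open>card R / card V ^ 2\<close>.\<close>

lemma card_PiE_pair:
  assumes "finite I" "finite V" "i \<in> I" "j \<in> I" "i \<noteq> j" "R \<subseteq> V \<times> V"
  shows "card {\<phi> \<in> I \<rightarrow>\<^sub>E V. (\<phi> i, \<phi> j) \<in> R} * card V ^ 2 = card R * card V ^ card I"
proof -
  let ?F = "\<lambda>(x,y). {\<phi> \<in> I \<rightarrow>\<^sub>E V. \<phi> i = x \<and> \<phi> j = y}"
  have finR: "finite R" using assms finite_subset by blast
  have fin: "finite (I \<rightarrow>\<^sub>E V)" using assms by (intro finite_PiE) auto
  have "{\<phi> \<in> I \<rightarrow>\<^sub>E V. (\<phi> i, \<phi> j) \<in> R} = (\<Union>q\<in>R. ?F q)" by auto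
  also have "card \<dots> = (\<Sum>q\<in>R. card (?F q))"
    using finR fin by (intro card_UN_disjoint) auto
  finally have "card {\<phi> \<in> I \<rightarrow>\<^sub>E V. (\<phi> i, \<phi> j) \<in> R} * card V ^ 2 = (\<Sum>q\<in>R. card (?F q) * card V ^ 2)"
    by (simp add: sum_distrib_right)
  also have "\<dots> = (\<Sum>q\<in>R. card V ^ card I)"
  proof (intro sum.cong refl)
    fix q assume "q \<in> R"
    then obtain x y where q: "q = (x,y)" "(x,y) \<in> R" by (cases q) auto
    then have "x \<in> V" "y \<in> V" using q assms by auto
    then show "card (?F q) * card V ^ 2 = card V ^ card I"
      using card_PiE_fixed[of I "{i,j}" "\<lambda>k. if k = i then x else y" V] assms by (simp add: q power2_eq_square)
  qed
  finally show ?thesis by simp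
qed

text \<open>Events at disjoint pairs of indices are independent, so their probabilities
  multiply.\<close>

lemma card_PiE_two_pairs:
  assumes "finite I" "finite V" "{i,j,k,l} \<subseteq> I" "i \<noteq> j" "k \<noteq> l" "{i,j} \<inter> {k,l} = {}" "R \<subseteq> V \<times> V"
  shows "card {\<phi> \<in> I \<rightarrow>\<^sub>E V. (\<phi> i, \<phi> j) \<in> R \<and> (\<phi> k, \<phi> l) \<in> R} * card V ^ 4 = (card R)\<^sup>2 * card V ^ card I"
proof -
  let ?F = "\<lambda>((x,y),(z,w)). {\<phi> \<in> I \<rightarrow>\<^sub>E V. \<phi> i = x \<and> \<phi> j = y \<and> \<phi> k = z \<and> \<phi> l = w}"
  have finR: "finite (R \<times> R)"
    using finite_subset[OF assms(7)] assms(2) by (simp add: finite_cartesian_product)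
  have fin: "finite (I \<rightarrow>\<^sub>E V)" using assms by (intro finite_PiE) auto
  have "{\<phi> \<in> I \<rightarrow>\<^sub>E V. (\<phi> i, \<phi> j) \<in> R \<and> (\<phi> k, \<phi> l) \<in> R} = (\<Union>q\<in>R\<times>R. ?F q)" by auto
  also have "card \<dots> = (\<Sum>q\<in>R\<times>R. card (?F q))"
    using finR fin by (intro card_UN_disjoint) auto
  finally have "card {\<phi> \<in> I \<rightarrow>\<^sub>E V. (\<phi> i, \<phi> j) \<in> R \<and> (\<phi> k, \<phi> l) \<in> R} * card V ^ 4 = (\<Sum>q\<in>R\<times>R. card (?F q) * card V ^ 4)"
    by (simp add: sum_distrib_right)
  also have "\<dots> = (\<Sum>q\<in>R\<times>R. card V ^ card I)"
  proof (intro sum.cong refl)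
    fix q assume "q \<in> R \<times> R"
    then obtain x y z w where q: "q = ((x,y),(z,w))" "(x,y) \<in> R" "(z,w) \<in> R" by auto
    then have "x \<in> V" "y \<in> V" "z \<in> V" "w \<in> V" using q assms by auto
    moreover have "card {i,j,k,l} = 4" using assms by auto
    moreover have "{\<phi> \<in> I \<rightarrow>\<^sub>E V. \<forall>h\<in>{i,j,k,l}. \<phi> h = (if h = i then x else if h = j then y else if h = k then z else w)}
       = ?F ((x,y),(z,w))" using assms by auto
    ultimately show "card (?F q) * card V ^ 4 = card V ^ card I"
      using card_PiE_fixed[of I "{i,j,k,l}" "\<lambda>h. if h = i then x else if h = j then y else if h = k then z else w" V] assms
      by (simp add: q(1) del: insert_iff)
  qed
  finally show ?thesis by (simp add: card_cartesian_product power2_eq_square)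
qed

text \<open>Union bound over the ordered pairs of distinct indices, each of which collides with
  probability \<open>1 / card V\<close>; a collision is the pair event for the relation
  \<open>Id_on V\<close>.\<close>

lemma card_noninjective:
  assumes "finite I" "finite V"
  shows "card {\<phi> \<in> I \<rightarrow>\<^sub>E V. \<not> inj_on \<phi> I} * card V \<le> (card I)\<^sup>2 * card V ^ card I"
proof (cases "V = {}")
  case True then show ?thesis by simp
next
  case False
  then have n: "card V > 0" using assms by (simp add: card_gt_0_iff)
  define P where "P = {(i,j). i \<in> I \<and> j \<in> I \<and> i \<noteq> j}"
  let ?F = "\<lambda>(i,j). {\<phi> \<in> I \<rightarrow>\<^sub>E V. (\<phi> i, \<phi> j) \<in> Id_on V}"
  have PI: "P \<subseteq> I \<times> I" by (auto simp: P_def)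
  have finP: "finite P" using PI assms finite_subset by blast
  have cP: "card P \<le> (card I)\<^sup>2"
    using card_mono[OF _ PI] assms by (simp add: card_cartesian_product power2_eq_square)
  have cId: "card (Id_on V) = card V"
    using card_image[of "\<lambda>x. (x,x)" V] by (simp add: inj_on_def Id_on_def UNION_singleton_eq_range)
  have *: "card (?F q) * card V = card V ^ card I" if qP: "q \<in> P" for q
  proof -
    obtain i j where q: "q = (i,j)" "i \<in> I" "j \<in> I" "i \<noteq> j" using qP unfolding P_def by blast
    have "card (?F q) * card V ^ 2 = card V * card V ^ card I"
      using card_PiE_pair[of I V i j "Id_on V"] assms q cId by (auto simp: Id_on_def)
    then show ?thesis using n by (simp add: power2_eq_square)
  qed
  have "{\<phi> \<in> I \<rightarrow>\<^sub>E V. \<not> inj_on \<phi> I} \<subseteq> (\<Union>q\<in>P. ?F q)"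
    by (fastforce simp: inj_on_def P_def)
  then have "card {\<phi> \<in> I \<rightarrow>\<^sub>E V. \<not> inj_on \<phi> I} \<le> card (\<Union>q\<in>P. ?F q)"
    using assms finP by (intro card_mono) (auto intro!: finite_PiE)
  also have "\<dots> \<le> (\<Sum>q\<in>P. card (?F q))" by (rule card_UN_le[OF finP])
  finally have "card {\<phi> \<in> I \<rightarrow>\<^sub>E V. \<not> inj_on \<phi> I} * card V \<le> (\<Sum>q\<in>P. card (?F q)) * card V" by simp
  also have "\<dots> = (\<Sum>q\<in>P. card (?F q) * card V)" by (simp add: sum_distrib_right)
  also have "\<dots> = (\<Sum>q\<in>P. card V ^ card I)" using * by (intro sum.cong refl) 
  also have "\<dots> = card P * card V ^ card I" by simp
  also have "\<dots> \<le> (card I)\<^sup>2 * card V ^ card I" using cP by simp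
  finally show ?thesis .
qed

text \<open>Ordered pairs make this a sum of indicators with mean \<open>m * (m - 1) * p\<close>.
  For the symmetric relation of an edge set every edge is counted twice, which is the source of the
  factors 2 below.\<close>

definition pair_count :: "('a \<times> 'a) set \<Rightarrow> 'i set \<Rightarrow> ('i \<Rightarrow> 'a) \<Rightarrow> nat" where
  "pair_count R I \<phi> = card {(i,j). i \<in> I \<and> j \<in> I \<and> i \<noteq> j \<and> (\<phi> i, \<phi> j) \<in> R}"

text \<open>Only the at most \<open>4m\<^sup>3\<close> couples of pairs that share an index contribute to the variance.\<close>

lemma pair_count_second_moment:
  fixes R :: "('a \<times> 'a) set" and I :: "'i set"
  assumes "finite I" "finite V" "V \<noteq> {}" "R \<subseteq> V \<times> V"
  defines "p \<equiv> real (card R) / real (card V) ^ 2" and "m \<equiv> real (card I)"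
  shows "(\<Sum>\<phi>\<in>I \<rightarrow>\<^sub>E V. (real (pair_count R I \<phi>) - m * (m - 1) * p)\<^sup>2) \<le> 4 * m ^ 3 * real (card V) ^ card I"
proof -
  define n where "n = real (card V)"
  define W where "W = n ^ card I"
  define \<Phi> where "\<Phi> = (I \<rightarrow>\<^sub>E V)"
  define P where "P = {(i,j). i \<in> I \<and> j \<in> I \<and> i \<noteq> j}"
  define f :: "'i \<times> 'i \<Rightarrow> ('i \<Rightarrow> 'a) \<Rightarrow> real" where "f q \<phi> = of_bool ((\<phi> (fst q), \<phi> (snd q)) \<in> R)" for q \<phi>
  define disj :: "'i \<times> 'i \<Rightarrow> 'i \<times> 'i \<Rightarrow> bool" where "disj q r \<longleftrightarrow> {fst q, snd q} \<inter> {fst r, snd r} = {}" for q r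
  have n: "n > 0" using assms by (simp add: n_def card_gt_0_iff)
  have W: "W > 0" using n by (simp add: W_def)
  have fin: "finite \<Phi>" using assms by (auto simp: \<Phi>_def intro!: finite_PiE)
  have c\<Phi>: "real (card \<Phi>) = W" using assms by (simp add: \<Phi>_def W_def n_def card_PiE)
  have PI: "P \<subseteq> I \<times> I" by (auto simp: P_def)
  have finP: "finite P" using PI assms finite_subset by blast
  have cP: "real (card P) = m * (m - 1)"
  proof -
    have "card P + card (Id_on I) = card (I \<times> I)"
    proof -
      have "P \<union> Id_on I = I \<times> I" "P \<inter> Id_on I = {}" by (auto simp: P_def Id_on_def)
      moreover have "finite (Id_on I)" using assms(1) by (simp add: Id_on_def)
      ultimately show ?thesis using card_Un_disjoint[OF finP] by metis
    qed
    moreover have "card (Id_on I) = card I"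
      using card_image[of "\<lambda>x. (x,x)" I] by (simp add: inj_on_def Id_on_def UNION_singleton_eq_range)
    ultimately have "real (card P) + m = m * m"
      by (simp add: m_def card_cartesian_product flip: of_nat_add of_nat_mult)
    then show ?thesis by (simp add: algebra_simps)
  qed
  have pc: "real (pair_count R I \<phi>) = (\<Sum>q\<in>P. f q \<phi>)" for \<phi>
  proof -
    have "pair_count R I \<phi> = card {q\<in>P. (\<phi> (fst q), \<phi> (snd q)) \<in> R}"
      unfolding pair_count_def by (intro arg_cong[where f = card]) (auto simp: P_def)
    then show ?thesis using finP by (simp add: f_def of_bool_def sum.If_cases Int_def)
  qed
  have sum_f: "(\<Sum>\<phi>\<in>\<Phi>. f q \<phi>) = p * W" if "q \<in> P" for q
  proof -
    have "(\<Sum>\<phi>\<in>\<Phi>. f q \<phi>) = real (card {\<phi>\<in>\<Phi>. (\<phi> (fst q), \<phi> (snd q)) \<in> R})"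
      using fin by (simp add: f_def of_bool_def sum.If_cases Int_def)
    moreover have "real (card {\<phi>\<in>\<Phi>. (\<phi> (fst q), \<phi> (snd q)) \<in> R}) * n ^ 2 = real (card R) * W"
      using card_PiE_pair[of I V "fst q" "snd q" R] assms that
      by (auto simp: \<Phi>_def P_def n_def W_def simp flip: of_nat_mult of_nat_power)
    ultimately show ?thesis using n by (simp add: p_def n_def[symmetric] field_simps)
  qed
  \<comment> \<open>Disjoint pairs are independent and give exactly \<open>p\<^sup>2 * W\<close>;
    for overlapping pairs the number \<open>W\<close> of all maps is bound enough.\<close>
  have sum_ff: "(\<Sum>\<phi>\<in>\<Phi>. f q \<phi> * f r \<phi>) \<le> p\<^sup>2 * W + (if disj q r then 0 else W)" if "q \<in> P" "r \<in> P" for q r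
  proof -
    have e: "(\<Sum>\<phi>\<in>\<Phi>. f q \<phi> * f r \<phi>) = real (card {\<phi>\<in>\<Phi>. (\<phi> (fst q), \<phi> (snd q)) \<in> R \<and> (\<phi> (fst r), \<phi> (snd r)) \<in> R})"
      using fin by (simp add: f_def of_bool_conj[symmetric] del: of_bool_conj) (simp add: of_bool_def sum.If_cases Int_def)
    show ?thesis
    proof (cases "disj q r")
      case True
      then have "real (card {\<phi>\<in>\<Phi>. (\<phi> (fst q), \<phi> (snd q)) \<in> R \<and> (\<phi> (fst r), \<phi> (snd r)) \<in> R}) * n ^ 4 = (real (card R))\<^sup>2 * W"
        using card_PiE_two_pairs[of I V "fst q" "snd q" "fst r" "snd r" R] assms(1-4) that
        by (auto simp: \<Phi>_def P_def n_def W_def disj_def simp flip: of_nat_mult of_nat_power)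
      then have "real (card {\<phi>\<in>\<Phi>. (\<phi> (fst q), \<phi> (snd q)) \<in> R \<and> (\<phi> (fst r), \<phi> (snd r)) \<in> R}) = p\<^sup>2 * W"
        using n by (simp add: p_def n_def[symmetric] field_simps power2_eq_square power4_eq_xxxx)
      then show ?thesis using e True by simp
    next
      case False
      have "card {\<phi>\<in>\<Phi>. (\<phi> (fst q), \<phi> (snd q)) \<in> R \<and> (\<phi> (fst r), \<phi> (snd r)) \<in> R} \<le> card \<Phi>"
        using fin by (intro card_mono) auto
      then have "(\<Sum>\<phi>\<in>\<Phi>. f q \<phi> * f r \<phi>) \<le> W" using e c\<Phi> by simp
      moreover have "p\<^sup>2 * W \<ge> 0" using W by simp
      ultimately show ?thesis using False by simp
    qed
  qed
  \<comment> \<open>A pair meeting \<open>q\<close> has one of the two entries of \<open>q\<close>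
    as its first or second entry, which leaves at most \<open>2 * m + 2 * m\<close> pairs.\<close>
  have nd: "real (card {r\<in>P. \<not> disj q r}) \<le> 4 * m" if "q \<in> P" for q
  proof -
    let ?a = "fst q" and ?b = "snd q"
    have "{r\<in>P. \<not> disj q r} \<subseteq> {?a,?b} \<times> I \<union> I \<times> {?a,?b}" 
    proof
      fix r assume "r \<in> {r\<in>P. \<not> disj q r}"
      then have "fst r \<in> I" "snd r \<in> I" "fst r \<in> {?a,?b} \<or> snd r \<in> {?a,?b}"
        by (auto simp: P_def disj_def)
      then show "r \<in> {?a,?b} \<times> I \<union> I \<times> {?a,?b}" by (cases r) auto
    qed
    then have "card {r\<in>P. \<not> disj q r} \<le> card ({?a,?b} \<times> I \<union> I \<times> {?a,?b})"
      using assms(1) by (intro card_mono) auto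
    also have "\<dots> \<le> card ({?a,?b} \<times> I) + card (I \<times> {?a,?b})" by (rule card_Un_le)
    also have "\<dots> \<le> 2 * card I + card I * 2"
      unfolding card_cartesian_product by (intro add_mono mult_mono) (auto simp: card_insert_if)
    finally show ?thesis by (simp add: m_def)
  qed
  have m0: "m \<ge> 0" by (simp add: m_def)
  have m2: "real (card P) \<le> m ^ 2"
    using cP m0 by (simp add: power2_eq_square algebra_simps)
  define \<mu> where "\<mu> = real (card P) * p"
  have s1: "(\<Sum>\<phi>\<in>\<Phi>. \<Sum>q\<in>P. f q \<phi>) = \<mu> * W"
    by (subst sum.swap) (simp add: sum_f \<mu>_def)
  have "(\<Sum>\<phi>\<in>\<Phi>. (\<Sum>q\<in>P. f q \<phi>)\<^sup>2) = (\<Sum>q\<in>P. \<Sum>r\<in>P. \<Sum>\<phi>\<in>\<Phi>. f q \<phi> * f r \<phi>)"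
    unfolding power2_eq_square sum_product
    by (subst sum.swap) (intro sum.cong refl, subst sum.swap, simp)
  also have "\<dots> \<le> (\<Sum>q\<in>P. \<Sum>r\<in>P. p\<^sup>2 * W + (if disj q r then 0 else W))"
    using sum_ff by (intro sum_mono)
  also have "\<dots> = (\<Sum>q\<in>P. real (card P) * (p\<^sup>2 * W) + real (card {r\<in>P. \<not> disj q r}) * W)"
    using finP by (simp add: sum.distrib sum.If_cases Int_def)
  also have "\<dots> \<le> (\<Sum>q\<in>P. real (card P) * (p\<^sup>2 * W) + 4 * m * W)"
    using nd W by (intro sum_mono add_left_mono mult_right_mono) auto
  also have "\<dots> = \<mu>\<^sup>2 * W + real (card P) * (4 * m * W)"
    by (simp add: \<mu>_def power2_eq_square algebra_simps)
  also have "\<dots> \<le> \<mu>\<^sup>2 * W + m ^ 2 * (4 * m * W)"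
    using m2 m0 W by (intro add_left_mono mult_right_mono) auto
  finally have s2: "(\<Sum>\<phi>\<in>\<Phi>. (\<Sum>q\<in>P. f q \<phi>)\<^sup>2) \<le> \<mu>\<^sup>2 * W + 4 * m ^ 3 * W"
    by (simp add: power2_eq_square power3_eq_cube)
  have "(\<Sum>\<phi>\<in>\<Phi>. ((\<Sum>q\<in>P. f q \<phi>) - \<mu>)\<^sup>2) =
     (\<Sum>\<phi>\<in>\<Phi>. (\<Sum>q\<in>P. f q \<phi>)\<^sup>2 - 2 * \<mu> * (\<Sum>q\<in>P. f q \<phi>) + \<mu>\<^sup>2)"
    by (intro sum.cong refl) (simp add: power2_diff)
  also have "\<dots> = (\<Sum>\<phi>\<in>\<Phi>. (\<Sum>q\<in>P. f q \<phi>)\<^sup>2) - 2 * \<mu> * (\<mu> * W) + W * \<mu>\<^sup>2"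
    by (simp add: sum.distrib sum_subtractf s1[symmetric] c\<Phi> flip: sum_distrib_left)
  also have "\<dots> \<le> 4 * m ^ 3 * W" using s2 by (simp add: power2_eq_square algebra_simps)
  finally show ?thesis by (simp add: pc \<mu>_def cP \<Phi>_def W_def n_def)
qed

text \<open>Chebyshev's inequality, multiplied out. Only the lower tail is recorded, since a surplus
  of edges can be deleted.\<close>

lemma pair_count_concentration:
  assumes "finite I" "finite V" "V \<noteq> {}" "R \<subseteq> V \<times> V" "L > 0"
  defines "p \<equiv> real (card R) / real (card V) ^ 2" and "m \<equiv> real (card I)"
  shows "real (card {\<phi> \<in> I \<rightarrow>\<^sub>E V. real (pair_count R I \<phi>) < m * (m - 1) * p - L}) * L\<^sup>2
    \<le> 4 * m ^ 3 * real (card V) ^ card I"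
proof -
  let ?B = "{\<phi> \<in> I \<rightarrow>\<^sub>E V. real (pair_count R I \<phi>) < m * (m - 1) * p - L}"
  let ?g = "\<lambda>\<phi>. (real (pair_count R I \<phi>) - m * (m - 1) * p)\<^sup>2"
  have "real (card ?B) * L\<^sup>2 = (\<Sum>\<phi>\<in>?B. L\<^sup>2)" by simp
  also have "\<dots> \<le> (\<Sum>\<phi>\<in>?B. ?g \<phi>)"
  proof (intro sum_mono)
    fix \<phi> assume "\<phi> \<in> ?B"
    then have "L \<le> \<bar>real (pair_count R I \<phi>) - m * (m - 1) * p\<bar>" by auto
    then show "L\<^sup>2 \<le> ?g \<phi>" using assms(5) by (metis abs_le_square_iff abs_of_pos)
  qed
  also have "\<dots> \<le> (\<Sum>\<phi>\<in>I \<rightarrow>\<^sub>E V. ?g \<phi>)"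
    using assms(1,2) by (intro sum_mono2) (auto intro!: finite_PiE)
  also have "\<dots> \<le> 4 * m ^ 3 * real (card V) ^ card I"
    using pair_count_second_moment[OF assms(1-4)] by (simp add: p_def m_def)
  finally show ?thesis .
qed

subsection \<open>Pulling back balanced graphs\<close>

lemma real_choose_two: "real (n choose 2) = real n * (real n - 1) / 2"
  by (induction n) (auto simp: numeral_2_eq_2 field_simps)

lemma card_ordered_pairs:
  assumes "finite E" "\<And>e. e \<in> E \<Longrightarrow> card e = 2"
  shows "card {(x, y). {x, y} \<in> E} = 2 * card E"
proof -
  let ?F = "\<lambda>e. {(x, y). {x, y} = e}"
  have F: "finite (?F e) \<and> card (?F e) = 2" if e: "e \<in> E" for e
  proof -
    obtain a b where ab: "e = {a, b}" "a \<noteq> b" using assms(2)[OF e] by (meson card_2_iff)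
    have "?F e = {(a, b), (b, a)}" unfolding ab(1) by (auto simp: doubleton_eq_iff)
    then show ?thesis using ab(2) by simp
  qed
  have "{(x, y). {x, y} \<in> E} = (\<Union>e\<in>E. ?F e)" by auto
  also have "card \<dots> = (\<Sum>e\<in>E. card (?F e))"
    using assms(1) F by (intro card_UN_disjoint) auto
  finally show ?thesis using F by simp
qed

text \<open>Passes from ordered pairs, which suit the variance computation, to the edges of the
  pulled-back graph.\<close>

lemma pair_count_edges:
  assumes "finite I"
  shows "pair_count {(x, y). {x, y} \<in> E} I \<phi> = 2 * card {e. e \<subseteq> I \<and> card e = 2 \<and> \<phi> ` e \<in> E}"
proof -
  let ?E = "{e. e \<subseteq> I \<and> card e = 2 \<and> \<phi> ` e \<in> E}"
  have eq: "{(i, j). {i, j} \<in> ?E} = {(i, j). i \<in> I \<and> j \<in> I \<and> i \<noteq> j \<and> (\<phi> i, \<phi> j) \<in> {(x, y). {x, y} \<in> E}}"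
    by (auto simp: card_insert_if split: if_splits)
  have "finite ?E" by (rule finite_subset[of _ "Pow I"]) (use assms in \<open>auto\<close>)
  then have "card {(i, j). {i, j} \<in> ?E} = 2 * card ?E" by (rule card_ordered_pairs) blast
  then show ?thesis unfolding eq pair_count_def .
qed

lemma finite_edges:
  assumes "bicolored_graph G"
  shows "finite (red G)" "finite (blue G)" "finite (edges G)"
proof -
  have "red G \<union> blue G \<subseteq> Pow (verts G)" "finite (Pow (verts G))"
    using assms by (auto simp: bicolored_graph_def)
  then have "finite (red G \<union> blue G)" by (rule finite_subset)
  then show "finite (red G)" "finite (blue G)" "finite (edges G)" by (auto simp: edges_def)
qed

lemma card_edges:
  assumes "bicolored_graph G"
  shows "card (edges G) = card (red G) + card (blue G)"
proof -
  have "red G \<inter> blue G = {}" using assms by (simp add: bicolored_graph_def)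
  then show ?thesis unfolding edges_def using finite_edges[OF assms] by (intro card_Un_disjoint)
qed

lemma card_edges_le:
  assumes "bicolored_graph G"
  shows "card (edges G) \<le> card (verts G) choose 2"
proof -
  have sub: "edges G \<subseteq> {e. e \<subseteq> verts G \<and> card e = 2}"
    using assms by (auto simp: edges_def bicolored_graph_def)
  have fin: "finite (verts G)" using assms by (simp add: bicolored_graph_def)
  have "finite {e. e \<subseteq> verts G \<and> card e = 2}"
    by (rule finite_subset[of _ "Pow (verts G)"]) (use fin in \<open>auto\<close>)
  then have "card (edges G) \<le> card {e. e \<subseteq> verts G \<and> card e = 2}" using sub by (rule card_mono)
  then show ?thesis unfolding n_subsets[OF fin, of 2] .
qed

text \<open>The condition inside \<open>contains\<close> with the map as an argument, because the
  counting below ranges over the maps themselves.\<close>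

definition embedding :: "('v \<Rightarrow> 'w) \<Rightarrow> 'v bicolored \<Rightarrow> 'w bicolored \<Rightarrow> bool" where
  "embedding f F G \<longleftrightarrow>
     inj_on f (verts F) \<and> f ` verts F \<subseteq> verts G \<and>
     (\<forall>e \<in> red F. f ` e \<in> red G) \<and> (\<forall>e \<in> blue F. f ` e \<in> blue G)"

lemma contains_iff_embedding: "contains G F \<longleftrightarrow> (\<exists>f. embedding f F G)"
  by (simp add: contains_def embedding_def)

lemma embedding_comp:
  assumes "embedding f F H" "embedding g H G"
  shows "embedding (g \<circ> f) F G"
proof -
  have "inj_on (g \<circ> f) (verts F)"
    using assms by (auto simp: embedding_def intro!: comp_inj_on intro: inj_on_subset)
  moreover have "(g \<circ> f) ` verts F \<subseteq> verts G" using assms by (fastforce simp: embedding_def)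
  moreover have "(g \<circ> f) ` e = g ` f ` e" for e by (simp add: image_image)
  ultimately show ?thesis using assms unfolding embedding_def by metis
qed

text \<open>Edges lie inside \<open>verts F\<close>, so only the values there matter. Embeddings can
  thus be made extensional, which leaves finitely many of them into \<open>{..<m}\<close>.\<close>

lemma embedding_cong:
  assumes "bicolored_graph F" "\<And>u. u \<in> verts F \<Longrightarrow> f u = g u"
  shows "embedding f F G \<longleftrightarrow> embedding g F G"
proof -
  have "f ` e = g ` e" if "e \<subseteq> verts F" for e using that assms(2) by (intro image_cong) auto
  moreover have "inj_on f (verts F) = inj_on g (verts F)" using assms(2) by (rule inj_on_cong)
  moreover have "e \<subseteq> verts F" if "e \<in> red F \<or> e \<in> blue F" for e
    using assms(1) that by (auto simp: bicolored_graph_def)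
  ultimately show ?thesis unfolding embedding_def by (metis order_refl)
qed

text \<open>
  If the first colour is the scarcer one, cut the second down to the largest number that the ratio
  \<open>(1 - \<epsilon>) / \<epsilon>\<close> permits. For \<open>\<epsilon> > 1/2\<close> balance forces \<open>r = b = 0\<close>.
\<close>

lemma trim_counts:
  fixes r b K \<epsilon> :: real and r' b' :: nat
  assumes \<epsilon>: "\<epsilon> > 0" and K: "K \<ge> 0" and nonneg: "r \<ge> 0" "b \<ge> 0"
    and bal: "\<epsilon> * (r + b) \<le> r" "\<epsilon> * (r + b) \<le> b" and near: "r - K \<le> real r'" "b - K \<le> real b'"
  shows "\<exists>x\<le>r'. \<exists>y\<le>b'. \<epsilon> * real (x + y) \<le> real x \<and> \<epsilon> * real (x + y) \<le> real y \<and>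
           r + b - 2 * K / \<epsilon> - 1 \<le> real (x + y)"
proof (cases "\<epsilon> \<le> 1/2")
  case False
  have "r + b \<le> 0"
  proof (rule ccontr)
    assume "\<not> r + b \<le> 0"
    then have "1/2 * (r + b) < \<epsilon> * (r + b)" using False by (intro mult_strict_right_mono) auto
    then show False using bal by simp
  qed
  moreover have "2 * K / \<epsilon> \<ge> 0" using \<epsilon> K by simp
  ultimately show ?thesis by (intro exI[of _ 0]) auto
next
  case True
  \<comment> \<open>The colours are interchangeable, so only \<open>r \<le> b\<close> is treated, in
    fresh variables that can later be instantiated with the colours swapped.\<close>
  have main: "\<exists>x\<le>r'. \<exists>y\<le>b'. \<epsilon> * real (x + y) \<le> real x \<and> \<epsilon> * real (x + y) \<le> real y \<and>
           r + b - 2 * K / \<epsilon> - 1 \<le> real (x + y)"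
    if bal: "\<epsilon> * (r + b) \<le> r" and near: "r - K \<le> real r'" "b - K \<le> real b'" and rb: "r \<le> b"
    for r b :: real and r' b' :: nat
  proof -
    \<comment> \<open>The errors can put \<open>b'\<close> below \<open>r'\<close> although
      \<open>r \<le> b\<close>; the minimum keeps \<open>x \<le> y\<close> and is still at least
      \<open>r - K\<close>.\<close>
    define x where "x = min r' b'"
    \<comment> \<open>\<open>\<epsilon> * (x + y) \<le> x\<close> is equivalent to
      \<open>y \<le> x * (1 - \<epsilon>) / \<epsilon>\<close>; rounding down costs the
      \<open>- 1\<close> in the claim.\<close>
    define y where "y = min b' (nat \<lfloor>real x * (1 - \<epsilon>) / \<epsilon>\<rfloor>)"
    have x: "real x \<ge> r - K" using near rb by (simp add: x_def min_def)
    have "1 \<le> (1 - \<epsilon>) / \<epsilon>" using True \<epsilon> by (simp add: field_simps)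
    then have xle: "real x \<le> real x * (1 - \<epsilon>) / \<epsilon>"
      using mult_left_mono[of 1 "(1 - \<epsilon>) / \<epsilon>" "real x"] by simp
    then have xf: "int x \<le> \<lfloor>real x * (1 - \<epsilon>) / \<epsilon>\<rfloor>" by (simp add: le_floor_iff)
    then have xy: "x \<le> y" by (simp add: y_def x_def)
    have nf: "real (nat \<lfloor>real x * (1 - \<epsilon>) / \<epsilon>\<rfloor>) = of_int \<lfloor>real x * (1 - \<epsilon>) / \<epsilon>\<rfloor>"
      using xf by simp
    have "real y \<le> real x * (1 - \<epsilon>) / \<epsilon>"
    proof -
      have "y \<le> nat \<lfloor>real x * (1 - \<epsilon>) / \<epsilon>\<rfloor>" by (simp add: y_def)
      then have "real y \<le> of_int \<lfloor>real x * (1 - \<epsilon>) / \<epsilon>\<rfloor>" unfolding nf[symmetric] by (rule of_nat_mono)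
      then show ?thesis using of_int_floor_le order_trans by blast
    qed
    then have b1: "\<epsilon> * real (x + y) \<le> real x" using \<epsilon> by (simp add: field_simps)
    have "\<epsilon> * real (x + y) \<le> (1/2) * real (x + y)" using True by (intro mult_right_mono) auto
    then have b2: "\<epsilon> * real (x + y) \<le> real y" using xy by simp
    have K\<epsilon>: "K \<le> K / \<epsilon>" using True \<epsilon> K mult_left_mono[of \<epsilon> 1 K] by (simp add: field_simps)
    \<comment> \<open>If all of \<open>b'\<close> is kept, only the two errors \<open>K\<close> are
      lost. Otherwise \<open>x + y\<close> is at least \<open>x / \<epsilon> - 1\<close>, and
      balance gives \<open>r / \<epsilon> \<ge> r + b\<close>.\<close>
    have "r + b - 2 * K / \<epsilon> - 1 \<le> real (x + y)"
    proof (cases "y = b'")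
      case True
      then show ?thesis using x near K\<epsilon> by simp
    next
      case False
      then have "real y = of_int \<lfloor>real x * (1 - \<epsilon>) / \<epsilon>\<rfloor>" using nf by (auto simp: y_def min_def split: if_splits)
      then have "real y \<ge> real x * (1 - \<epsilon>) / \<epsilon> - 1" by linarith
      then have "real (x + y) \<ge> real x / \<epsilon> - 1" using \<epsilon> by (simp add: field_simps)
      moreover have "real x / \<epsilon> \<ge> (r - K) / \<epsilon>" using x \<epsilon> by (intro divide_right_mono) auto
      moreover have "r / \<epsilon> \<ge> r + b" using bal \<epsilon> by (simp add: field_simps)
      moreover have "K / \<epsilon> \<ge> 0" using \<epsilon> K by simp
      ultimately show ?thesis by (simp add: diff_divide_distrib)
    qed
    moreover have "x \<le> r'" "y \<le> b'" by (auto simp: x_def y_def)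
    ultimately show ?thesis using b1 b2 by blast
  qed
  show ?thesis
  proof (cases "r \<le> b")
    case True
    then show ?thesis by (rule main[OF bal(1) near])
  next
    case False
    then have "b \<le> r" by simp
    moreover have "\<epsilon> * (b + r) \<le> b" using bal(2) by (simp only: add.commute)
    ultimately obtain y x where "y \<le> b'" "x \<le> r'" "\<epsilon> * real (y + x) \<le> real y" "\<epsilon> * real (y + x) \<le> real x"
      "b + r - 2 * K / \<epsilon> - 1 \<le> real (y + x)"
      using main[OF _ near(2,1)] by blast
    then show ?thesis by (intro exI[of _ x] conjI exI[of _ y]) (simp_all only: add.commute)
  qed
qed

text \<open>Scaling by \<open>s\<close> preserves the balance conditions, so
  \<open>trim_counts\<close> applies to the scaled counts with error \<open>K\<close>. Any sets of
  pulled-back edges of the resulting sizes will do, because \<open>\<phi>\<close> remains an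
  embedding when edges are deleted.\<close>

lemma balanced_pullback:
  fixes G :: "'w bicolored" and \<phi> :: "'i \<Rightarrow> 'w"
  assumes \<epsilon>: "\<epsilon> > 0" and G: "bicolored_graph G" "balanced \<epsilon> G" and "finite I" "s \<ge> 0" "K \<ge> 0"
    and \<phi>: "\<phi> ` I \<subseteq> verts G" "inj_on \<phi> I"
    and count: "real (pair_count {(x, y). {x, y} \<in> red G} I \<phi>) \<ge> 2 * (s * real (card (red G)) - K)"
      "real (pair_count {(x, y). {x, y} \<in> blue G} I \<phi>) \<ge> 2 * (s * real (card (blue G)) - K)"
  shows "\<exists>H. bicolored_graph H \<and> verts H = I \<and> balanced \<epsilon> H \<and> embedding \<phi> H G \<and>
           real (card (edges H)) \<ge> s * real (card (edges G)) - 2 * K / \<epsilon> - 1"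
proof -
  define pull where "pull E = {e. e \<subseteq> I \<and> card e = 2 \<and> \<phi> ` e \<in> E}" for E
  have fin: "finite (pull E)" for E
    by (rule finite_subset[of _ "Pow I"]) (use assms(4) in \<open>auto simp: pull_def\<close>)
  have ce: "real (card (edges G)) = real (card (red G)) + real (card (blue G))"
    using card_edges[OF G(1)] by simp
  have bal: "\<epsilon> * (s * real (card (red G)) + s * real (card (blue G))) \<le> s * real (card (red G))"
    "\<epsilon> * (s * real (card (red G)) + s * real (card (blue G))) \<le> s * real (card (blue G))"
    using G(2) mult_left_mono[OF _ assms(5)] unfolding balanced_def ce
    by (metis distrib_left mult.left_commute)+
  have near: "s * real (card (red G)) - K \<le> real (card (pull (red G)))"
    "s * real (card (blue G)) - K \<le> real (card (pull (blue G)))"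
    using count unfolding pair_count_edges[OF assms(4)] by (simp_all add: pull_def)
  have nn: "s * real (card (red G)) \<ge> 0" "s * real (card (blue G)) \<ge> 0" using assms(5) by auto
  obtain x y where xy: "x \<le> card (pull (red G))" "y \<le> card (pull (blue G))"
    "\<epsilon> * real (x + y) \<le> real x" "\<epsilon> * real (x + y) \<le> real y"
    "s * real (card (red G)) + s * real (card (blue G)) - 2 * K / \<epsilon> - 1 \<le> real (x + y)"
    using trim_counts[OF \<epsilon> assms(6) nn bal near] by auto
  obtain R where R: "R \<subseteq> pull (red G)" "card R = x" using xy(1) by (meson obtain_subset_with_card_n)
  obtain B where B: "B \<subseteq> pull (blue G)" "card B = y" using xy(2) by (meson obtain_subset_with_card_n)
  define H where "H = \<lparr>verts = I, red = R, blue = B\<rparr>"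
  have "red G \<inter> blue G = {}" using G(1) by (simp add: bicolored_graph_def)
  then have "bicolored_graph H"
    using R B assms(4) by (fastforce simp: H_def bicolored_graph_def pull_def)
  moreover from this have "card (edges H) = x + y" using R B by (simp add: card_edges) (simp add: H_def)
  moreover have "embedding \<phi> H G" using \<phi> R B by (auto simp: embedding_def H_def pull_def)
  ultimately show ?thesis
    using xy R B by (intro exI[of _ H]) (simp add: balanced_def H_def ce distrib_left)
qed

section \<open>Random samples of balanced graphs\<close>

text \<open>\<open>H\<close> is some subgraph of the pull-back, as the full pull-back is only nearly
  balanced. Its vertices are natural numbers, so that it competes in \<open>ex_num\<close>.\<close>

definition balanced_samples :: "real \<Rightarrow> real \<Rightarrow> nat \<Rightarrow> 'w bicolored \<Rightarrow> (nat \<Rightarrow> 'w) set" where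
  "balanced_samples \<epsilon> d m G = {\<phi> \<in> {..<m} \<rightarrow>\<^sub>E verts G. \<exists>H :: nat bicolored.
     bicolored_graph H \<and> verts H = {..<m} \<and> balanced \<epsilon> H \<and> embedding \<phi> H G \<and>
     real (card (edges H)) \<ge> d * real (m choose 2)}"

text \<open>Three events can spoil a sample: a collision, too few red pairs, too few blue pairs.
  Each has probability at most 1/8, so more than half of the maps remain. Concentration needs
  \<open>m\<close> large in terms of \<open>\<epsilon>\<close> and \<open>\<eta>\<close>;
  injectivity then needs \<open>n\<close> large in terms of \<open>m\<close>.\<close>

lemma balanced_sampling:
  fixes \<epsilon> \<eta> :: real
  assumes \<epsilon>: "\<epsilon> > 0" and \<eta>: "\<eta> > 0"
  shows "\<exists>M\<ge>2. \<forall>m\<ge>M. \<exists>N\<ge>2. \<forall>n\<ge>N. \<forall>G :: 'w bicolored.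
     bicolored_graph G \<and> card (verts G) = n \<and> balanced \<epsilon> G \<longrightarrow>
     real n ^ m / 2 \<le> real (card (balanced_samples \<epsilon> (real (card (edges G)) / real (n choose 2) - \<eta>) m G))"
proof -
  \<comment> \<open>Chosen so that the trimming loss \<open>2 * K / \<epsilon>\<close> with
    \<open>K = \<kappa> * B\<close> equals \<open>\<eta> / 4 * B\<close>.\<close>
  define \<kappa> where "\<kappa> = \<eta> * \<epsilon> / 8"
  have \<kappa>: "\<kappa> > 0" using \<epsilon> \<eta> by (simp add: \<kappa>_def)
  \<comment> \<open>\<open>128 / \<kappa>\<^sup>2\<close> brings the Chebyshev bound down to 1/8,
    and \<open>1 + 4 / \<eta>\<close> lets \<open>\<eta> / 4 * B\<close> absorb the rounding loss
    1.\<close>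
  define M where "M = max 2 (max (nat \<lceil>128 / \<kappa>\<^sup>2\<rceil>) (nat \<lceil>1 + 4 / \<eta>\<rceil>))"
  have key: "real n ^ m / 2 \<le> real (card (balanced_samples \<epsilon> (real (card (edges G)) / real (n choose 2) - \<eta>) m G))"
    (is "_ \<le> real (card ?good)")
    if m: "m \<ge> M" and nN: "n \<ge> max 2 (max (8 * m\<^sup>2) (nat \<lceil>4 / \<eta>\<rceil>))"
      and G: "bicolored_graph G" "card (verts G) = n" "balanced \<epsilon> G"
    for m n :: nat and G :: "'w bicolored"
  proof -
    define V where "V = verts G"
    define W where "W = real n ^ m"
    define B where "B = real (m choose 2)"
    define K where "K = \<kappa> * B"
    \<comment> \<open>The expected number of index pairs mapped to an edge of \<open>E\<close> is
      \<open>s * card E\<close>. The denominator is \<open>n\<^sup>2\<close> because the sampling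
      allows repetitions.\<close>
    define s where "s = real m * (real m - 1) / (real n)\<^sup>2"
    define \<Phi> where "\<Phi> = ({..<m} \<rightarrow>\<^sub>E V)"
    define R where "R E = {(x, y). {x, y} \<in> E}" for E :: "'w set set"
    define bad where "bad E = {\<phi> \<in> \<Phi>. real (pair_count (R E) {..<m} \<phi>) < 2 * (s * real (card E) - K)}"
      for E :: "'w set set"
    define noninj where "noninj = {\<phi> \<in> \<Phi>. \<not> inj_on \<phi> {..<m}}"
    have mb: "m \<ge> 2" "real m \<ge> 128 / \<kappa>\<^sup>2" "real m \<ge> 1 + 4 / \<eta>" using m by (auto simp: M_def)
    \<comment> \<open>\<open>8 * m\<^sup>2\<close> bounds the collision probability by 1/8;
      \<open>4 / \<eta>\<close> controls the error of replacing \<open>n * (n - 1)\<close> by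
      \<open>n\<^sup>2\<close>.\<close>
    have nb: "n \<ge> 2" "n \<ge> 8 * m\<^sup>2" "real n \<ge> 4 / \<eta>" using nN by auto
    have V: "finite V" "card V = n" "V \<noteq> {}" using G nb by (auto simp: V_def bicolored_graph_def)
    have W: "W > 0" using nb by (simp add: W_def)
    have Beq: "B = real m * (real m - 1) / 2" by (simp add: B_def real_choose_two)
    have fin: "finite \<Phi>" unfolding \<Phi>_def using V by (intro finite_PiE) auto
    have c\<Phi>: "real (card \<Phi>) = W" using V by (simp add: \<Phi>_def W_def card_PiE)
    have ni: "real (card noninj) \<le> W / 8"
    proof -
      have "card noninj * n \<le> m\<^sup>2 * n ^ m"
        using card_noninjective[of "{..<m}" V] V by (simp add: noninj_def \<Phi>_def)
      then have "real (card noninj) * real n \<le> (real m)\<^sup>2 * W"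
        unfolding W_def by (metis of_nat_mono of_nat_mult of_nat_power)
      also have "\<dots> \<le> (real n / 8) * W"
      proof (rule mult_right_mono)
        have "real (8 * m\<^sup>2) \<le> real n" using nb(2) by (rule of_nat_mono)
        then show "(real m)\<^sup>2 \<le> real n / 8" by simp
      qed (use W in simp)
      finally have "real (card noninj) * real n \<le> (W / 8) * real n" by (simp add: mult.commute)
      then show ?thesis using nb(1) by (subst (asm) mult_le_cancel_right_pos) auto
    qed
    have bad: "real (card (bad E)) \<le> W / 8" if E: "finite E" "\<And>e. e \<in> E \<Longrightarrow> e \<subseteq> V \<and> card e = 2" for E
    proof -
      have RV: "R E \<subseteq> V \<times> V" using E by (fastforce simp: R_def)
      have cR: "card (R E) = 2 * card E" unfolding R_def using E by (intro card_ordered_pairs) auto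
      have "2 * K = \<kappa> * (real m * (real m - 1))" by (simp add: K_def Beq)
      moreover have "real m * (real m - 1) > 0" using mb by simp
      ultimately have L: "2 * K > 0" using \<kappa> by simp
      have "real (card {..<m}) * (real (card {..<m}) - 1) * (real (card (R E)) / (real (card V))\<^sup>2) - 2 * K
          = 2 * (s * real (card E) - K)"
        by (simp add: s_def V cR)
      then have "real (card (bad E)) * (2 * K)\<^sup>2 \<le> 4 * real m ^ 3 * W"
        using pair_count_concentration[of "{..<m}" V "R E" "2 * K"] V RV L
        by (simp add: bad_def \<Phi>_def W_def)
      moreover have "32 * real m ^ 3 \<le> (2 * K)\<^sup>2"
      proof -
        have "128 \<le> \<kappa>\<^sup>2 * real m" using mb(2) \<kappa> by (simp add: field_simps)
        then have "128 * (real m ^ 3 / 4) \<le> (\<kappa>\<^sup>2 * real m) * (real m ^ 3 / 4)" by (intro mult_right_mono) auto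
        also have "\<dots> = \<kappa>\<^sup>2 * (real m * (real m / 2))\<^sup>2" by (simp add: power2_eq_square power3_eq_cube)
        also have "\<dots> \<le> \<kappa>\<^sup>2 * (real m * (real m - 1))\<^sup>2"
          using mb(1) by (intro mult_left_mono power_mono) auto
        also have "\<dots> = (2 * K)\<^sup>2" by (simp add: K_def Beq power_mult_distrib)
        finally show ?thesis by simp
      qed
      then have "real (card (bad E)) * (32 * real m ^ 3) \<le> real (card (bad E)) * (2 * K)\<^sup>2"
        by (intro mult_left_mono) auto
      ultimately have "real (card (bad E)) * (32 * real m ^ 3) \<le> 4 * real m ^ 3 * W" by (rule order_trans[rotated])
      then have "real (card (bad E)) * (32 * real m ^ 3) \<le> (W / 8) * (32 * real m ^ 3)" by (simp add: mult.commute)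
      then show ?thesis using mb(1) by (subst (asm) mult_le_cancel_right_pos) auto
    qed
    have "\<Phi> \<subseteq> ?good \<union> (noninj \<union> (bad (red G) \<union> bad (blue G)))"
    proof
      fix \<phi> assume \<phi>: "\<phi> \<in> \<Phi>"
      show "\<phi> \<in> ?good \<union> (noninj \<union> (bad (red G) \<union> bad (blue G)))"
      proof (cases "\<phi> \<in> noninj \<union> (bad (red G) \<union> bad (blue G))")
        case False
        have "\<phi> ` {..<m} \<subseteq> verts G" using \<phi> by (auto simp: \<Phi>_def V_def)
        moreover have "inj_on \<phi> {..<m}" using False \<phi> by (auto simp: noninj_def)
        moreover have "real (pair_count (R (red G)) {..<m} \<phi>) \<ge> 2 * (s * real (card (red G)) - K)"
          "real (pair_count (R (blue G)) {..<m} \<phi>) \<ge> 2 * (s * real (card (blue G)) - K)"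
          using False \<phi> by (auto simp: bad_def)
        moreover have "s \<ge> 0" using mb(1) by (simp add: s_def)
        moreover have "K \<ge> 0" using \<kappa> by (simp add: K_def B_def)
        ultimately obtain H where H: "bicolored_graph H" "verts H = {..<m}" "balanced \<epsilon> H" "embedding \<phi> H G"
           "real (card (edges H)) \<ge> s * real (card (edges G)) - 2 * K / \<epsilon> - 1"
          using balanced_pullback[OF \<epsilon> G(1,3), of "{..<m}" s K \<phi>] by (auto simp: R_def)
        \<comment> \<open>Three losses of at most \<open>\<eta> / 4 * B\<close> each: from
          \<open>n\<^sup>2\<close> in place of \<open>n * (n - 1)\<close>, from trimming, and from
          rounding.\<close>
        have "(real (card (edges G)) / real (n choose 2) - \<eta>) * B \<le> s * real (card (edges G)) - 2 * K / \<epsilon> - 1"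
        proof -
          define e where "e = real (card (edges G))"
          define c where "c = real (n choose 2)"
          have n1: "real n > 1" using nb by simp
          have c: "c = real n * (real n - 1) / 2" by (simp add: c_def real_choose_two)
          have c0: "c > 0" using n1 by (simp add: c)
          have ec: "e \<le> c" using card_edges_le[OF G(1)] G(2) by (simp add: e_def c_def)
          have "e / c - 2 * e / (real n)\<^sup>2 = (e / c) / real n"
            using n1 by (simp add: c field_simps power2_eq_square)
          also have "\<dots> \<le> 1 / real n" using ec c0 by (intro divide_right_mono) auto
          also have "\<dots> \<le> \<eta> / 4" using nb \<eta> n1 by (simp add: field_simps)
          finally have "e / c \<le> 2 * e / (real n)\<^sup>2 + \<eta> / 4" by linarith
          then have "(e / c) * B \<le> (2 * e / (real n)\<^sup>2 + \<eta> / 4) * B"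
            by (intro mult_right_mono) (auto simp: B_def)
          moreover have "2 * e / (real n)\<^sup>2 * B = s * e" by (simp add: s_def Beq)
          moreover have "2 * K / \<epsilon> = (\<eta> / 4) * B" using \<epsilon> by (simp add: K_def \<kappa>_def)
          moreover have "1 \<le> (\<eta> / 4) * B"
          proof -
            have "real m - 1 \<ge> 4 / \<eta>" using mb(3) by simp
            moreover have "1 * (real m - 1) \<le> real m / 2 * (real m - 1)" using mb(1) by (intro mult_right_mono) auto
            ultimately have "4 / \<eta> \<le> B" by (simp add: Beq)
            then show ?thesis using \<eta> by (simp add: field_simps)
          qed
          moreover have "\<eta> * B \<ge> 0" using \<eta> by (simp add: B_def)
          ultimately show ?thesis unfolding e_def[symmetric] c_def[symmetric]
            by (simp add: algebra_simps)
        qed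
        then have "real (card (edges H)) \<ge> (real (card (edges G)) / real (n choose 2) - \<eta>) * real (m choose 2)"
          using H(5) unfolding B_def by linarith
        then show ?thesis using \<phi> H(1-4) unfolding \<Phi>_def V_def balanced_samples_def by blast
      qed blast
    qed
    moreover have finG: "finite ?good" using fin unfolding \<Phi>_def V_def balanced_samples_def by simp
    moreover have "finite noninj" "finite (bad E)" for E using fin by (simp_all add: noninj_def bad_def)
    ultimately have "card \<Phi> \<le> card (?good \<union> (noninj \<union> (bad (red G) \<union> bad (blue G))))"
      by (intro card_mono) auto
    also have "\<dots> \<le> card ?good + (card noninj + (card (bad (red G)) + card (bad (blue G))))"
      by (intro order_trans[OF card_Un_le] add_mono order_refl)
    finally have "W \<le> real (card ?good) + (real (card noninj) + (real (card (bad (red G))) + real (card (bad (blue G)))))"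
      unfolding c\<Phi>[symmetric] by linarith
    moreover have "real (card (bad (red G))) \<le> W / 8" "real (card (bad (blue G))) \<le> W / 8"
      by (rule bad; use G(1) finite_edges[OF G(1)] in \<open>simp add: bicolored_graph_def V_def\<close>)+
    ultimately show ?thesis using ni W unfolding W_def[symmetric] by linarith
  qed
  show ?thesis
  proof (rule exI[of _ M], intro conjI allI impI)
    show "2 \<le> M" by (simp add: M_def)
    fix m assume m: "M \<le> m"
    let ?N = "max 2 (max (8 * m\<^sup>2) (nat \<lceil>4 / \<eta>\<rceil>))"
    show "\<exists>N\<ge>2. \<forall>n\<ge>N. \<forall>G :: 'w bicolored.
     bicolored_graph G \<and> card (verts G) = n \<and> balanced \<epsilon> G \<longrightarrow>
     real n ^ m / 2 \<le> real (card (balanced_samples \<epsilon> (real (card (edges G)) / real (n choose 2) - \<eta>) m G))"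
      by (rule exI[of _ ?N], rule conjI, rule max.cobounded1, intro allI impI, elim conjE)
        (rule key[OF m]; assumption)
  qed
qed

subsection \<open>Existence of the limit density\<close>

text \<open>A bounded sequence has a convergent monotone subsequence. Almost-decrease from a term of
  that subsequence bounds all late terms above, and almost-decrease towards a still later term of it
  bounds them below.\<close>

lemma convergent_if_almost_decreasing:
  fixes x :: "nat \<Rightarrow> real"
  assumes "\<And>n. \<bar>x n\<bar> \<le> C" and dec: "\<And>\<eta>. \<eta> > 0 \<Longrightarrow> \<exists>M. \<forall>m\<ge>M. \<exists>N. \<forall>n\<ge>N. x n \<le> x m + \<eta>"
  shows "convergent x"
proof -
  have "Bseq x" by (rule BseqI'[of _ C]) (use assms(1) in auto)
  obtain r where r: "strict_mono r" "monoseq (\<lambda>n. x (r n))" using seq_monosub[of x] by blast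
  have "Bseq (\<lambda>n. x (r n))" using Bseq_subseq[OF \<open>Bseq x\<close>] .
  then obtain l where l: "(\<lambda>n. x (r n)) \<longlonglongrightarrow> l"
    using r(2) Bseq_monoseq_convergent convergent_def by metis
  have "x \<longlonglongrightarrow> l"
  proof (rule LIMSEQ_I)
    fix e :: real assume e: "e > 0"
    obtain M where M: "\<And>m. m \<ge> M \<Longrightarrow> \<exists>N. \<forall>n\<ge>N. x n \<le> x m + e/3" using dec[of "e/3"] e by auto
    obtain k0 where k0: "\<And>k. k \<ge> k0 \<Longrightarrow> \<bar>x (r k) - l\<bar> < e/3"
      using LIMSEQ_D[OF l, of "e/3"] e by auto
    define k where "k = max k0 M"
    have "r k \<ge> M" using seq_suble[OF r(1), of k] by (simp add: k_def)
    then obtain N where N: "\<And>n. n \<ge> N \<Longrightarrow> x n \<le> x (r k) + e/3" using M by blast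
    have "\<bar>x n - l\<bar> < e" if n: "n \<ge> max M N" for n
    proof -
      have "x n \<le> x (r k) + e/3" using N n by simp
      moreover have "x (r k) < l + e/3" using k0[of k] unfolding k_def by linarith
      ultimately have "x n < l + e" using e by simp
      \<comment> \<open>For the lower bound \<open>x n\<close> itself is the earlier term, compared
        with a term of the subsequence far beyond \<open>n\<close>.\<close>
      obtain N' where N': "\<And>j. j \<ge> N' \<Longrightarrow> x j \<le> x n + e/3" using M n by (meson max.boundedE)
      define j where "j = max k0 N'"
      have "r j \<ge> N'" using seq_suble[OF r(1), of j] by (simp add: j_def)
      then have "x (r j) \<le> x n + e/3" by (rule N')
      moreover have "x (r j) > l - e/3" using k0[of j] unfolding j_def by linarith
      ultimately have "x n > l - e" using e by simp
      with \<open>x n < l + e\<close> show ?thesis by (simp add: abs_less_iff)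
    qed
    then show "\<exists>n0. \<forall>n\<ge>n0. norm (x n - l) < e" unfolding real_norm_def by blast
  qed
  then show ?thesis by (rule convergentI)
qed

section \<open>Extremal numbers as maxima over finite sets\<close>

definition extremal_sizes :: "real \<Rightarrow> nat \<Rightarrow> 'v bicolored set \<Rightarrow> nat set" where
  "extremal_sizes \<epsilon> n \<F> = {card (edges G) | G :: nat bicolored.
     bicolored_graph G \<and> card (verts G) = n \<and> balanced \<epsilon> G \<and> (\<forall>F \<in> \<F>. \<not> contains G F)}"

lemma ex_num_eq_Sup: "ex_num \<epsilon> n \<F> = Sup (extremal_sizes \<epsilon> n \<F>)"
  by (simp add: ex_num_def extremal_sizes_def)

lemma extremal_sizes_le: "extremal_sizes \<epsilon> n \<F> \<subseteq> {..n choose 2}"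
  using card_edges_le by (auto simp: extremal_sizes_def)

lemma finite_extremal_sizes: "finite (extremal_sizes \<epsilon> n \<F>)"
  using extremal_sizes_le by (rule finite_subset) simp

lemma ex_num_ge:
  fixes G :: "nat bicolored"
  assumes "bicolored_graph G" "card (verts G) = n" "balanced \<epsilon> G" "\<forall>F \<in> \<F>. \<not> contains G F"
  shows "card (edges G) \<le> ex_num \<epsilon> n \<F>"
proof -
  have "card (edges G) \<in> extremal_sizes \<epsilon> n \<F>" using assms by (auto simp: extremal_sizes_def)
  then show ?thesis unfolding ex_num_eq_Sup
    by (intro cSup_upper) (auto simp: finite_extremal_sizes)
qed

text \<open>The set of sizes is finite, so if nonempty it attains its supremum; if empty, the
  supremum is the default value 0.\<close>

lemma ex_num_cases:
  obtains "ex_num \<epsilon> n \<F> = 0"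
  | G :: "nat bicolored" where "bicolored_graph G" "card (verts G) = n" "balanced \<epsilon> G"
      "\<forall>F \<in> \<F>. \<not> contains G F" "ex_num \<epsilon> n \<F> = card (edges G)"
proof (cases "extremal_sizes \<epsilon> n \<F> = {}")
  case True
  then show ?thesis using that(1) by (simp add: ex_num_eq_Sup Sup_nat_def)
next
  case False
  then have "ex_num \<epsilon> n \<F> \<in> extremal_sizes \<epsilon> n \<F>"
    unfolding ex_num_eq_Sup using Max_in[OF finite_extremal_sizes False] by (simp add: Sup_nat_def)
  then show ?thesis using that(2) by (auto simp: extremal_sizes_def)
qed

lemma ex_num_le: "ex_num \<epsilon> n \<F> \<le> n choose 2"
  by (rule ex_num_cases[of \<epsilon> n \<F>]) (use card_edges_le in force)+

text \<open>Gives \<open>lim\<close> in \<open>ex_density\<close> its meaning. A sample of an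
  extremal graph on \<open>n\<close> vertices avoids the family as well, so its density, at least
  \<open>x n - \<eta>\<close>, is at most \<open>x m\<close>.\<close>

lemma ex_density_tendsto:
  assumes "\<epsilon> > 0"
  shows "(\<lambda>n. real (ex_num \<epsilon> n \<F>) / real (n choose 2)) \<longlonglongrightarrow> ex_density \<epsilon> \<F>"
proof -
  define x where "x n = real (ex_num \<epsilon> n \<F>) / real (n choose 2)" for n
  have x0: "x n \<ge> 0" for n by (simp add: x_def)
  have "x n \<le> 1" for n using ex_num_le[of \<epsilon> n \<F>]
    by (cases "n choose 2 = 0") (simp_all add: x_def divide_le_eq_1)
  then have bd: "\<bar>x n\<bar> \<le> 1" for n using x0 by (simp add: abs_le_iff order_trans[OF _ x0])
  have "\<exists>M. \<forall>m\<ge>M. \<exists>N. \<forall>n\<ge>N. x n \<le> x m + \<eta>" if \<eta>: "\<eta> > 0" for \<eta>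
  proof -
    obtain M where M: "M \<ge> 2" "\<forall>m\<ge>M. \<exists>N\<ge>2. \<forall>n\<ge>N. \<forall>G :: nat bicolored.
     bicolored_graph G \<and> card (verts G) = n \<and> balanced \<epsilon> G \<longrightarrow>
     real n ^ m / 2 \<le> real (card (balanced_samples \<epsilon> (real (card (edges G)) / real (n choose 2) - \<eta>) m G))"
      using balanced_sampling[OF assms \<eta>, where 'w = nat] by (elim exE conjE)
    show ?thesis
    proof (rule exI[of _ M], intro allI impI)
      fix m assume m: "M \<le> m"
      obtain N where N: "N \<ge> 2" "\<forall>n\<ge>N. \<forall>G :: nat bicolored.
       bicolored_graph G \<and> card (verts G) = n \<and> balanced \<epsilon> G \<longrightarrow>
       real n ^ m / 2 \<le> real (card (balanced_samples \<epsilon> (real (card (edges G)) / real (n choose 2) - \<eta>) m G))"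
        using M(2)[rule_format, OF m] by (elim exE conjE)
      have "x n \<le> x m + \<eta>" if n: "n \<ge> N" for n
      proof (rule ex_num_cases[of \<epsilon> n \<F>])
        assume "ex_num \<epsilon> n \<F> = 0"
        then show ?thesis using x0[of m] \<eta> by (simp add: x_def)
      next
        fix G :: "nat bicolored"
        assume G: "bicolored_graph G" "card (verts G) = n" "balanced \<epsilon> G"
          "\<forall>F \<in> \<F>. \<not> contains G F" "ex_num \<epsilon> n \<F> = card (edges G)"
        let ?S = "balanced_samples \<epsilon> (real (card (edges G)) / real (n choose 2) - \<eta>) m G"
        have "real n ^ m / 2 \<le> real (card ?S)" using N(2)[rule_format, OF n] G by blast
        moreover have "real n ^ m / 2 > 0" using n N(1) by simp
        \<comment> \<open>A single good sample is enough here; the proportion of good samples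
          matters only for the blow-up.\<close>
        ultimately have "card ?S \<noteq> 0" by linarith
        then have "?S \<noteq> {}" by (metis card.empty)
        then obtain \<phi> and H :: "nat bicolored" where H: "bicolored_graph H" "verts H = {..<m}" "balanced \<epsilon> H"
          "embedding \<phi> H G"
          "real (card (edges H)) \<ge> (real (card (edges G)) / real (n choose 2) - \<eta>) * real (m choose 2)"
          unfolding balanced_samples_def by blast
        have "\<forall>F \<in> \<F>. \<not> contains H F"
          using G(4) H(4) embedding_comp unfolding contains_iff_embedding by blast
        then have "card (edges H) \<le> ex_num \<epsilon> m \<F>" using H by (intro ex_num_ge) auto
        then have "(x n - \<eta>) * real (m choose 2) \<le> real (ex_num \<epsilon> m \<F>)"
          using H(5) by (simp add: x_def G(5))
        moreover have "real (m choose 2) > 0" using m M(1) by (simp add: zero_less_binomial)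
        ultimately have "x n - \<eta> \<le> x m" by (simp add: x_def pos_le_divide_eq)
        then show ?thesis by simp
      qed
      then show "\<exists>N. \<forall>n\<ge>N. x n \<le> x m + \<eta>" by blast
    qed
  qed
  then have "convergent x" using bd by (rule convergent_if_almost_decreasing[rotated])
  then show ?thesis unfolding ex_density_def x_def convergent_LIMSEQ_iff .
qed

subsection \<open>Blow-ups\<close>

text \<open>The vertex \<open>(u, k)\<close> goes to the \<open>k\<close>-th element of
  \<open>A (f u)\<close>. Two elements of different classes lie on a common \<open>\<phi>\<close> of
  the box, whose embedding property handles the edge between them. The size \<open>Suc t\<close>
  keeps the classes nonempty when \<open>t = 0\<close>.\<close>

lemma contains_blow_up:
  fixes G :: "'w bicolored" and F :: "'v bicolored" and f :: "'v \<Rightarrow> 'i"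
  assumes F: "bicolored_graph F" and f: "inj_on f (verts F)" "f ` verts F \<subseteq> I"
    and A: "\<And>i. i \<in> I \<Longrightarrow> card (A i) = Suc t"
    and emb: "\<And>\<phi>. \<phi> \<in> PiE I A \<Longrightarrow> inj_on \<phi> I \<and> embedding (\<phi> \<circ> f) F G"
  shows "contains G (blow_up t F)"
proof -
  have "\<exists>e. bij_betw e {..<Suc t} (A i)" if "i \<in> I" for i
    using A[OF that] by (intro bij_betw_iff_card[THEN iffD2]) (auto intro: card_ge_0_finite)
  then obtain e where e: "\<And>i. i \<in> I \<Longrightarrow> bij_betw (e i) {..<Suc t} (A i)" by metis
  have eA: "e i k \<in> A i" if "i \<in> I" "k < t" for i k
    using e[OF that(1)] that(2) by (auto simp: bij_betw_def)
  have fI: "f u \<in> I" if "u \<in> verts F" for u using f(2) that by auto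
  define h where "h = (\<lambda>(u, k). e (f u) k)"
  \<comment> \<open>The remaining coordinates are filled with the element number 0 of their
    class.\<close>
  have choose: "\<exists>\<phi>\<in>PiE I A. \<phi> i = x \<and> \<phi> j = y" if "i \<in> I" "j \<in> I" "i \<noteq> j" "x \<in> A i" "y \<in> A j" for i j x y
  proof (rule bexI[of _ "\<lambda>k\<in>I. if k = i then x else if k = j then y else e k 0"])
    have "e k 0 \<in> A k" if "k \<in> I" for k using e[OF that] by (auto simp: bij_betw_def)
    then show "(\<lambda>k\<in>I. if k = i then x else if k = j then y else e k 0) \<in> PiE I A" using that by auto
  qed (use that in auto)
  have choose1: "\<exists>\<phi>\<in>PiE I A. \<phi> i = x" if "i \<in> I" "x \<in> A i" for i x
  proof (rule bexI[of _ "\<lambda>k\<in>I. if k = i then x else e k 0"])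
    have "e k 0 \<in> A k" if "k \<in> I" for k using e[OF that] by (auto simp: bij_betw_def)
    then show "(\<lambda>k\<in>I. if k = i then x else e k 0) \<in> PiE I A" using that by auto
  qed (use that in auto)
  have inj: "inj_on h (verts F \<times> {..<t})"
  proof (intro inj_onI, clarsimp simp: h_def)
    fix u k v l assume a: "u \<in> verts F" "v \<in> verts F" "k < t" "l < t" "e (f u) k = e (f v) l"
    \<comment> \<open>Distinct classes are disjoint: a common element would be the value of one
      injective \<open>\<phi>\<close> at two indices.\<close>
    have fuv: "f u = f v"
    proof (rule ccontr)
      assume ne: "f u \<noteq> f v"
      obtain \<phi> where "\<phi> \<in> PiE I A" "\<phi> (f u) = e (f u) k" "\<phi> (f v) = e (f v) l"
        using choose[OF fI[OF a(1)] fI[OF a(2)] ne eA[OF fI[OF a(1)] a(3)] eA[OF fI[OF a(2)] a(4)]] by blast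
      then show False using emb a(5) ne fI a(1,2) by (metis inj_onD)
    qed
    then have "k = l" using e[OF fI[OF a(1)]] a(3-5) by (auto simp: bij_betw_def inj_on_def)
    moreover have "u = v" using fuv f(1) a(1,2) by (simp add: inj_on_def)
    ultimately show "u = v \<and> k = l" by simp
  qed
  have edge: "\<exists>\<phi>\<in>PiE I A. h ` {(u, k), (v, l)} = (\<phi> \<circ> f) ` {u, v}"
    if uvkl: "{u, v} \<in> red F \<union> blue F" "k < t" "l < t" for u v k l
  proof -
    have uv: "u \<in> verts F" "v \<in> verts F" "u \<noteq> v"
      using F that(1) by (force simp: bicolored_graph_def)+
    then have ne: "f u \<noteq> f v" using f(1) by (auto simp: inj_on_def)
    obtain \<phi> where "\<phi> \<in> PiE I A" "\<phi> (f u) = e (f u) k" "\<phi> (f v) = e (f v) l"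
      using choose[OF fI[OF uv(1)] fI[OF uv(2)] ne eA[OF fI[OF uv(1)] uvkl(2)] eA[OF fI[OF uv(2)] uvkl(3)]]
      by blast
    then show ?thesis by (intro bexI[of _ \<phi>]) (simp_all add: h_def)
  qed
  have "h ` (verts F \<times> {..<t}) \<subseteq> verts G"
  proof clarsimp
    fix u k assume u: "u \<in> verts F" "k < t"
    obtain \<phi> where "\<phi> \<in> PiE I A" "\<phi> (f u) = e (f u) k"
      using choose1[OF fI[OF u(1)] eA[OF fI[OF u(1)] u(2)]] by blast
    then show "h (u, k) \<in> verts G" using emb[of \<phi>] u(1) by (force simp: embedding_def h_def)
  qed
  moreover have "h ` d \<in> red G" if d: "d \<in> red (blow_up t F)" for d
  proof -
    obtain u v k l where "d = {(u, k), (v, l)}" "{u, v} \<in> red F" "k < t" "l < t"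
      using d by (auto simp: blow_up_def)
    then show ?thesis using edge[of u v k l] emb unfolding embedding_def by (metis UnI1)
  qed
  moreover have "h ` d \<in> blue G" if d: "d \<in> blue (blow_up t F)" for d
  proof -
    obtain u v k l where "d = {(u, k), (v, l)}" "{u, v} \<in> blue F" "k < t" "l < t"
      using d by (auto simp: blow_up_def)
    then show ?thesis using edge[of u v k l] emb unfolding embedding_def by (metis UnI2)
  qed
  moreover have "verts (blow_up t F) = verts F \<times> {..<t}" by (simp add: blow_up_def)
  ultimately show ?thesis using inj unfolding contains_def by (intro exI[of _ h]) simp
qed

theorem theorem3p6:
  fixes \<epsilon> \<delta> c :: real and t :: nat and \<F> :: "'v bicolored set"
  assumes "\<epsilon> > 0" and "\<delta> > 0"
    and "finite \<F>" and "\<forall>F \<in> \<F>. bicolored_graph F"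
    and "c = ex_density \<epsilon> \<F>"
  shows "\<exists>N. \<forall>n \<ge> N. \<forall>G :: 'w bicolored.
           bicolored_graph G \<and> card (verts G) = n \<and> balanced \<epsilon> G \<and>
           real (card (edges G)) \<ge> (c + \<delta>) * real (n choose 2) \<longrightarrow>
           (\<exists>F \<in> \<F>. contains G (blow_up t F))"
proof -
  \<comment> \<open>One third of \<open>\<delta>\<close> is lost in sampling and one third separates
    the extremal density for \<open>m\<close> from \<open>c\<close>; then
    \<open>c + \<delta> - \<eta>\<close> still exceeds \<open>c + \<eta>\<close>.\<close>
  define \<eta> where "\<eta> = \<delta> / 3"
  have \<eta>: "\<eta> > 0" using assms(2) by (simp add: \<eta>_def)
  obtain M where M: "M \<ge> 2" "\<forall>m\<ge>M. \<exists>N\<ge>2. \<forall>n\<ge>N. \<forall>G :: 'w bicolored.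
   bicolored_graph G \<and> card (verts G) = n \<and> balanced \<epsilon> G \<longrightarrow>
   real n ^ m / 2 \<le> real (card (balanced_samples \<epsilon> (real (card (edges G)) / real (n choose 2) - \<eta>) m G))"
    using balanced_sampling[OF assms(1) \<eta>, where 'w = 'w] by (elim exE conjE)
  obtain m0 where m0: "\<And>m. m \<ge> m0 \<Longrightarrow> \<bar>real (ex_num \<epsilon> m \<F>) / real (m choose 2) - c\<bar> < \<eta>"
    using LIMSEQ_D[OF ex_density_tendsto[OF assms(1), of \<F>] \<eta>] assms(5) by auto
  define m where "m = max M m0"
  obtain N where N: "N \<ge> 2" "\<forall>n\<ge>N. \<forall>G :: 'w bicolored.
   bicolored_graph G \<and> card (verts G) = n \<and> balanced \<epsilon> G \<longrightarrow>
   real n ^ m / 2 \<le> real (card (balanced_samples \<epsilon> (real (card (edges G)) / real (n choose 2) - \<eta>) m G))"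
    using M(2)[rule_format, of m] by (auto simp only: m_def max.cobounded1)
  have m2: "real (m choose 2) > 0" using M(1) by (simp add: m_def zero_less_binomial)
  have exm: "real (ex_num \<epsilon> m \<F>) < (c + \<eta>) * real (m choose 2)"
    using m0[of m] m2 by (simp add: m_def abs_less_iff field_simps)
  \<comment> \<open>The possible positions of members of the family in \<open>{..<m}\<close>; their
    number does not depend on \<open>n\<close>.\<close>
  define Q where "Q = (SIGMA F:\<F>. verts F \<rightarrow>\<^sub>E {..<m})"
  have finQ: "finite Q" unfolding Q_def
    using assms(3,4) by (intro finite_SigmaI finite_PiE) (auto simp: bicolored_graph_def)
  \<comment> \<open>Half of the maps are shared among \<open>card Q\<close> positions; the
    \<open>+ 1\<close> makes the averaging strict and keeps the denominator positive when
    \<open>Q\<close> is empty.\<close>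
  define \<beta> where "\<beta> = 1 / (2 * (real (card Q) + 1))"
  have \<beta>: "\<beta> > 0" by (simp add: \<beta>_def)
  obtain L where L: "\<forall>V :: 'w set. \<forall>S. finite V \<and> card V \<ge> L \<and> S \<subseteq> ({..<m} \<rightarrow>\<^sub>E V) \<and>
           real (card S) \<ge> \<beta> * real (card V) ^ card {..<m} \<longrightarrow>
           (\<exists>A. (\<forall>i\<in>{..<m}. A i \<subseteq> V \<and> card (A i) = Suc t) \<and> (PiE {..<m} A) \<subseteq> S)"
    using erdos_box[OF finite_lessThan \<beta> zero_less_Suc] by (rule exE)
  have key: "\<exists>F \<in> \<F>. contains G (blow_up t F)"
    if n: "n \<ge> max N L" and G: "bicolored_graph G" "card (verts G) = n" "balanced \<epsilon> G"
      "real (card (edges G)) \<ge> (c + \<delta>) * real (n choose 2)"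
    for n and G :: "'w bicolored"
  proof -
    let ?S = "balanced_samples \<epsilon> (real (card (edges G)) / real (n choose 2) - \<eta>) m G"
    \<comment> \<open>Injectivity of \<open>\<phi>\<close> on all of \<open>{..<m}\<close> is
      recorded because it makes the classes of a box disjoint.\<close>
    define T where "T = (\<lambda>(F :: 'v bicolored, f). {\<phi> \<in> {..<m} \<rightarrow>\<^sub>E verts G. inj_on \<phi> {..<m} \<and> inj_on f (verts F) \<and>
      embedding (\<phi> \<circ> f) F G})"
    have n2: "n \<ge> 2" using n N(1) by simp
    have finV: "finite (verts G)" using G(1) by (simp add: bicolored_graph_def)
    have finT: "finite (T q)" for q
      using finV by (auto simp: T_def split: prod.split intro!: finite_subset[OF _ finite_PiE[of "{..<m}" "\<lambda>_. verts G"]])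
    have "?S \<subseteq> (\<Union>q\<in>Q. T q)"
    proof
      fix \<phi> assume "\<phi> \<in> ?S"
      then obtain H :: "nat bicolored" where \<phi>: "\<phi> \<in> {..<m} \<rightarrow>\<^sub>E verts G"
        and H: "bicolored_graph H" "verts H = {..<m}" "balanced \<epsilon> H" "embedding \<phi> H G"
          "real (card (edges H)) \<ge> (real (card (edges G)) / real (n choose 2) - \<eta>) * real (m choose 2)"
        unfolding balanced_samples_def by blast
      have "real (n choose 2) > 0" using n2 by (simp add: zero_less_binomial)
      then have "c + \<delta> \<le> real (card (edges G)) / real (n choose 2)" using G(4) by (simp add: pos_le_divide_eq)
      then have "(c + \<eta>) * real (m choose 2) \<le> (real (card (edges G)) / real (n choose 2) - \<eta>) * real (m choose 2)"
        using m2 assms(2) by (intro mult_right_mono) (auto simp: \<eta>_def)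
      \<comment> \<open>\<open>H\<close> is balanced on \<open>m\<close> vertices and exceeds the
        extremal number, so it cannot avoid the family.\<close>
      then have "card (edges H) > ex_num \<epsilon> m \<F>" using H(5) exm by linarith
      then have "\<exists>F\<in>\<F>. contains H F"
        using ex_num_ge[of H m \<epsilon> \<F>] H(1-3) by (auto simp: not_less[symmetric])
      then obtain F g where F: "F \<in> \<F>" and g: "embedding g F H" by (auto simp: contains_iff_embedding)
      define f where "f = restrict g (verts F)"
      have f: "embedding f F H"
        using g embedding_cong[of F f g] F assms(4) by (simp add: f_def)
      have "f \<in> verts F \<rightarrow>\<^sub>E {..<m}" using f H(2) by (auto simp: embedding_def f_def)
      then have "(F, f) \<in> Q" using F by (simp add: Q_def)
      moreover have "\<phi> \<in> T (F, f)"
        using \<phi> f H(2,4) embedding_comp[OF f H(4)] by (simp add: T_def embedding_def)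
      ultimately show "\<phi> \<in> (\<Union>q\<in>Q. T q)" by blast
    qed
    then have "card ?S \<le> card (\<Union>q\<in>Q. T q)" using finQ finT by (intro card_mono) auto
    also have "\<dots> \<le> (\<Sum>q\<in>Q. card (T q))" by (rule card_UN_le[OF finQ])
    finally have "real (card ?S) \<le> (\<Sum>q\<in>Q. real (card (T q)))"
      unfolding of_nat_sum[symmetric] by (rule of_nat_mono)
    moreover have "real n ^ m / 2 \<le> real (card ?S)"
    proof (rule N(2)[rule_format])
      show "N \<le> n" using n by simp
    qed (intro conjI G)
    ultimately have sum: "real n ^ m / 2 \<le> (\<Sum>q\<in>Q. real (card (T q)))" by linarith
    have "\<exists>q\<in>Q. real (card (T q)) \<ge> \<beta> * real n ^ m"
    proof (rule ccontr)
      assume "\<not> ?thesis"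
      then have "(\<Sum>q\<in>Q. real (card (T q))) \<le> (\<Sum>q\<in>Q. \<beta> * real n ^ m)" by (intro sum_mono) force
      also have "\<dots> = real (card Q) / (real (card Q) + 1) * (real n ^ m / 2)" by (simp add: \<beta>_def)
      also have "\<dots> < 1 * (real n ^ m / 2)"
        using n2 by (intro mult_strict_right_mono) (auto simp: divide_less_eq)
      finally show False using sum by simp
    qed
    then obtain F f where q: "(F, f) \<in> Q" "real (card (T (F, f))) \<ge> \<beta> * real n ^ m" by fast
    have "\<exists>A. (\<forall>i\<in>{..<m}. A i \<subseteq> verts G \<and> card (A i) = Suc t) \<and> (PiE {..<m} A) \<subseteq> T (F, f)"
      using L[rule_format, of "verts G" "T (F, f)"] finV G(2) n q(2) by (force simp: T_def)
    then obtain A where A: "\<And>i. i \<in> {..<m} \<Longrightarrow> card (A i) = Suc t" "PiE {..<m} A \<subseteq> T (F, f)" by blast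
    have F: "F \<in> \<F>" "f ` verts F \<subseteq> {..<m}" using q(1) by (auto simp: Q_def)
    \<comment> \<open>Injectivity of \<open>f\<close> is part of the condition in \<open>T\<close>,
      so any member of \<open>T (F, f)\<close> yields it.\<close>
    have "T (F, f) \<noteq> {}"
    proof -
      have "\<beta> * real n ^ m > 0" using \<beta> n2 by simp
      then have "card (T (F, f)) \<noteq> 0" using q(2) by linarith
      then show ?thesis by auto
    qed
    then have "inj_on f (verts F)" by (auto simp: T_def)
    then have "contains G (blow_up t F)"
      using F assms(4) A by (intro contains_blow_up[where I = "{..<m}" and A = A and f = f]) (auto simp: T_def)
    then show ?thesis using F by blast
  qed
  show ?thesis
    by (rule exI[of _ "max N L"], intro allI impI, elim conjE) (rule key; assumption)
qed

end
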